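(* Let $1\le p<\infty$, let $a\in G$, let $w$ be a weight on $G$, and let $T_{a,w}$ be the weighted translation on $L^p(G)$. If $T_{a,w}$ satisfies (DCCW), then $T_{a,w}$ is distributionally chaotic.
   Context: $G$ is a second countable locally compact Hausdorff group with a right invariant Haar measure $\lambda$; $L^p(G)$ is the complex Lebesgue space with respect to $\lambda$. A weight on $G$ is a bounded continuous function $w:G\to(0,\infty)$. For $a\in G$, $(T_af)(x):=f(xa^{-1})$ and the weighted translation is $T_{a,w}f:=w\,T_af$ for $f\in L^p(G)$. For $n\in\mathbb{N}=\{1,2,\dots\}$ put $\varphi_n:=\prod_{j=1}^nT_{a^{-j}}w$, i.e. $\varphi_n(x)=\prod_{j=1}^n w(xa^j)$. For a compact set $K\subseteq G$, $\|\varphi_n|_K\|_p=\left(\int_K\varphi_n^p\,d\lambda\right)^{1/p}$. For $A\subset\mathbb{N}$, $\overline{\mathrm{dens}}(A)=\limsup_{n\to\infty}\frac{\mathrm{card}(A\cap[1,n])}{n}$. The notation $\lim_{n\in A}$ means the limit as $n\to\infty$ with $n\in A$. (DCCW): $T_{a,w}$ satisfies the Distributional Chaos Criterion for Weighted Translations (DCCW) if there exists a sequence $(g_n)$ in $G$ such that (i) there exist $A\subset\mathbb{N}$ with $\overline{\mathrm{dens}}(A)=1$ and a sequence of compact neighborhoods $K_n$ of $g_n$ such that $\lim_{n\in A}\|\varphi_n|_{K_k}\|_p=0$ for all $k$; and (ii) there exists $B\subset\mathbb{N}$ with $\overline{\mathrm{dens}}(B)>0$ such that $\sum_{n\in B}\frac{1}{\varphi_n(g_n)}<\infty$.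 A bounded linear operator $T$ on a Banach space $X$ is distributionally chaotic if there exist an uncountable set $\Gamma\subset X$ and $\varepsilon>0$ such that for every $\tau>0$ and every pair of distinct $x,y\in\Gamma$, $\overline{\mathrm{dens}}\{n\in\mathbb{N}:\|T^nx-T^ny\|\ge\varepsilon\}=1$ and $\overline{\mathrm{dens}}\{n\in\mathbb{N}:\|T^nx-T^ny\|<\tau\}=1$. *)

theory Defs
  imports "HOL-Analysis.Analysis"
begin

text \<open>
  Groups are written additively, because the library's type class for possibly
  non-commutative topological groups is \<open>topological_group_add\<close> (no
  commutativity is assumed there).  Hence \<open>x + a\<close> stands for the product \<open>xa\<close> and
  \<open>x - a = x + (- a)\<close> for \<open>xa\<^sup>-\<^sup>1\<close>.  Indices and
  index sets range over the positive integers \<open>{1..}\<close>; the value of a sequence at \<open>0\<close>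
  is never used.
\<close>

text \<open>A nonzero, right-invariant Radon measure on the Borel sets.\<close>

definition right_Haar_measure :: "'a::topological_group_add measure \<Rightarrow> bool" where
  "right_Haar_measure M \<longleftrightarrow>
     sets M = sets borel \<and>
     (\<forall>K. compact K \<longrightarrow> emeasure M K < \<infinity>) \<and>
     (\<forall>A\<in>sets borel. emeasure M A = (INF U\<in>{U. open U \<and> A \<subseteq> U}. emeasure M U)) \<and>
     (\<forall>U. open U \<longrightarrow> emeasure M U = (SUP K\<in>{K. compact K \<and> K \<subseteq> U}. emeasure M K)) \<and>
     emeasure M UNIV \<noteq> 0 \<and>
     (\<forall>A\<in>sets borel. \<forall>g. emeasure M ((\<lambda>x. x + g) ` A) = emeasure M A)"

text \<open>
  \<open>Lp_fun M p\<close> is the set of \<open>p\<close>-integrable functions; the points of the Banach space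
  \<open>Lp_space M p\<close> are its classes modulo equality almost everywhere.
\<close>

definition Lp_fun :: "'a measure \<Rightarrow> real \<Rightarrow> ('a \<Rightarrow> complex) set" where
  "Lp_fun M p = {f \<in> borel_measurable M. integrable M (\<lambda>x. norm (f x) powr p)}"

definition Lp_rel :: "'a measure \<Rightarrow> real \<Rightarrow> (('a \<Rightarrow> complex) \<times> ('a \<Rightarrow> complex)) set" where
  "Lp_rel M p = {(f, g). f \<in> Lp_fun M p \<and> g \<in> Lp_fun M p \<and> (AE x in M. f x = g x)}"

definition Lp_space :: "'a measure \<Rightarrow> real \<Rightarrow> ('a \<Rightarrow> complex) set set" where
  "Lp_space M p = Lp_fun M p // Lp_rel M p"

definition Lp_fnorm :: "'a measure \<Rightarrow> real \<Rightarrow> ('a \<Rightarrow> complex) \<Rightarrow> real" where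
  "Lp_fnorm M p f = (LINT x|M. norm (f x) powr p) powr (1 / p)"

definition Lp_norm :: "'a measure \<Rightarrow> real \<Rightarrow> ('a \<Rightarrow> complex) set \<Rightarrow> real" where
  "Lp_norm M p X = the_elem (Lp_fnorm M p ` X)"

definition Lp_diff ::
  "'a measure \<Rightarrow> real \<Rightarrow> ('a \<Rightarrow> complex) set \<Rightarrow> ('a \<Rightarrow> complex) set \<Rightarrow> ('a \<Rightarrow> complex) set" where
  "Lp_diff M p X Y = (\<Union>f\<in>X. \<Union>g\<in>Y. Lp_rel M p `` {\<lambda>x. f x - g x})"

definition weight :: "('a::topological_space \<Rightarrow> real) \<Rightarrow> bool" where
  "weight w \<longleftrightarrow> continuous_on UNIV w \<and> bounded (range w) \<and> (\<forall>x. 0 < w x)"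

definition translation :: "'a::group_add \<Rightarrow> ('a \<Rightarrow> 'b) \<Rightarrow> 'a \<Rightarrow> 'b" where
  "translation a f = (\<lambda>x. f (x - a))"

definition wtrans_fun ::
  "'a::group_add \<Rightarrow> ('a \<Rightarrow> real) \<Rightarrow> ('a \<Rightarrow> complex) \<Rightarrow> 'a \<Rightarrow> complex" where
  "wtrans_fun a w f = (\<lambda>x. complex_of_real (w x) * translation a f x)"

definition weighted_translation ::
  "'a::group_add measure \<Rightarrow> real \<Rightarrow> 'a \<Rightarrow> ('a \<Rightarrow> real) \<Rightarrow> ('a \<Rightarrow> complex) set \<Rightarrow> ('a \<Rightarrow> complex) set" where
  "weighted_translation M p a w X = (\<Union>f\<in>X. Lp_rel M p `` {wtrans_fun a w f})"

text \<open>\<open>nat_mult j a\<close> is the group power \<open>a\<^sup>j\<close> in additive notation.\<close>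

definition nat_mult :: "nat \<Rightarrow> 'a::group_add \<Rightarrow> 'a" where
  "nat_mult j a = ((\<lambda>y. y + a) ^^ j) 0"

definition phi :: "'a::group_add \<Rightarrow> ('a \<Rightarrow> real) \<Rightarrow> nat \<Rightarrow> 'a \<Rightarrow> real" where
  "phi a w n x = (\<Prod>j=1..n. translation (- nat_mult j a) w x)"

definition restricted_norm :: "'a measure \<Rightarrow> real \<Rightarrow> ('a \<Rightarrow> real) \<Rightarrow> 'a set \<Rightarrow> real" where
  "restricted_norm M p h K = (LINT x:K|M. h x powr p) powr (1 / p)"

definition upper_dens :: "nat set \<Rightarrow> ereal" where
  "upper_dens A = limsup (\<lambda>n. ereal (real (card (A \<inter> {1..n})) / real n))"

definition DCCW ::
  "'a::topological_group_add measure \<Rightarrow> real \<Rightarrow> 'a \<Rightarrow> ('a \<Rightarrow> real) \<Rightarrow> bool" where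
  "DCCW M p a w \<longleftrightarrow>
     (\<exists>g :: nat \<Rightarrow> 'a.
        (\<exists>A \<subseteq> {1..}. upper_dens A = 1 \<and>
           (\<exists>K :: nat \<Rightarrow> 'a set.
              (\<forall>n\<ge>1. compact (K n) \<and> g n \<in> interior (K n)) \<and>
              (\<forall>k\<ge>1. ((\<lambda>n. restricted_norm M p (phi a w n) (K k)) \<longlongrightarrow> 0)
                        (inf sequentially (principal A))))) \<and>
        (\<exists>B \<subseteq> {1..}. upper_dens B > 0 \<and> (\<lambda>n. 1 / phi a w n (g n)) summable_on B))"

text \<open>
  \<open>Lp_space M p\<close> depends on the terms \<open>M\<close> and \<open>p\<close>, so it is not a type; the normed space on
  which \<open>T\<close> acts is therefore given by its carrier \<open>X\<close>, its subtraction \<open>diff\<close> and its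
  norm \<open>nrm\<close>.  That \<open>T\<close> is a bounded linear operator is presupposed, not part of the
  definition; for weighted translations it follows from \<open>wtrans_fun_Lp\<close> and
  \<open>weighted_translation_class\<close> below.
\<close>

definition distributionally_chaotic ::
  "'v set \<Rightarrow> ('v \<Rightarrow> 'v \<Rightarrow> 'v) \<Rightarrow> ('v \<Rightarrow> real) \<Rightarrow> ('v \<Rightarrow> 'v) \<Rightarrow> bool" where
  "distributionally_chaotic X diff nrm T \<longleftrightarrow>
     (\<exists>\<Gamma> \<epsilon>. \<Gamma> \<subseteq> X \<and> uncountable \<Gamma> \<and> \<epsilon> > 0 \<and>
        (\<forall>\<tau>>0. \<forall>x\<in>\<Gamma>. \<forall>y\<in>\<Gamma>. x \<noteq> y \<longrightarrow>
           upper_dens {n. 1 \<le> n \<and> nrm (diff ((T ^^ n) x) ((T ^^ n) y)) \<ge> \<epsilon>} = 1 \<and>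
           upper_dens {n. 1 \<le> n \<and> nrm (diff ((T ^^ n) x) ((T ^^ n) y)) < \<tau>} = 1))"

lemma equiv_Lp_rel: "equiv (Lp_fun M p) (Lp_rel M p)"
proof (rule equivI)
  show "Lp_rel M p \<subseteq> Lp_fun M p \<times> Lp_fun M p"
    by (auto simp: Lp_rel_def)
  show "refl_on (Lp_fun M p) (Lp_rel M p)"
    by (simp add: refl_on_def Lp_rel_def)
  show "sym (Lp_rel M p)"
  proof (rule symI)
    fix f g assume fg: "(f, g) \<in> Lp_rel M p"
    then have "AE x in M. f x = g x" by (simp add: Lp_rel_def)
    then have "AE x in M. g x = f x" by eventually_elim simp
    then show "(g, f) \<in> Lp_rel M p" using fg by (simp add: Lp_rel_def)
  qed
  show "trans (Lp_rel M p)"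
  proof (rule transI)
    fix f g h assume *: "(f, g) \<in> Lp_rel M p" "(g, h) \<in> Lp_rel M p"
    then have "AE x in M. f x = g x" "AE x in M. g x = h x" by (simp_all add: Lp_rel_def)
    then have "AE x in M. f x = h x" by eventually_elim simp
    then show "(f, h) \<in> Lp_rel M p" using * by (simp add: Lp_rel_def)
  qed
qed

lemma Lp_norm_class:
  assumes "f \<in> Lp_fun M p"
  shows "Lp_norm M p (Lp_rel M p `` {f}) = Lp_fnorm M p f"
proof -
  have "Lp_fnorm M p g = Lp_fnorm M p f" if "(f, g) \<in> Lp_rel M p" for g
  proof -
    have [measurable]: "f \<in> borel_measurable M" "g \<in> borel_measurable M"
      and ae: "AE x in M. f x = g x"
      using that by (auto simp: Lp_rel_def Lp_fun_def)
    have "(LINT x|M. norm (g x) powr p) = (LINT x|M. norm (f x) powr p)"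
    proof (rule integral_cong_AE)
      show "AE x in M. norm (g x) powr p = norm (f x) powr p"
        using ae by eventually_elim simp
    qed measurable
    then show ?thesis by (simp add: Lp_fnorm_def)
  qed
  moreover have "(f, f) \<in> Lp_rel M p"
    using assms by (simp add: Lp_rel_def)
  ultimately have "Lp_fnorm M p ` (Lp_rel M p `` {f}) = {Lp_fnorm M p f}"
    by blast
  then show ?thesis by (simp add: Lp_norm_def)
qed

lemma Lp_fun_diff:
  assumes p: "1 \<le> p" and f: "f \<in> Lp_fun M p" and g: "g \<in> Lp_fun M p"
  shows "(\<lambda>x. f x - g x) \<in> Lp_fun M p"
proof -
  have [measurable]: "f \<in> borel_measurable M" "g \<in> borel_measurable M"
    and int: "integrable M (\<lambda>x. norm (f x) powr p)" "integrable M (\<lambda>x. norm (g x) powr p)"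
    using f g by (auto simp: Lp_fun_def)
  have "norm (f x - g x) powr p \<le> 2 powr p * (norm (f x) powr p + norm (g x) powr p)" for x
  proof -
    have "norm (f x - g x) powr p \<le> (2 * max (norm (f x)) (norm (g x))) powr p"
      using p norm_triangle_ineq4[of "f x" "g x"] by (intro powr_mono2) auto
    also have "\<dots> = 2 powr p * max (norm (f x)) (norm (g x)) powr p"
      by (simp add: powr_mult)
    also have "\<dots> \<le> 2 powr p * (norm (f x) powr p + norm (g x) powr p)"
      by (intro mult_left_mono) (auto simp: max_def)
    finally show ?thesis .
  qed
  then have "integrable M (\<lambda>x. norm (f x - g x) powr p)"
    using int
    by (intro Bochner_Integration.integrable_bound[where g = "\<lambda>x. norm (f x - g x) powr p" and
          f = "\<lambda>x. 2 powr p * (norm (f x) powr p + norm (g x) powr p)"])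
       (auto simp del: powr_eq_0_iff)
  then show ?thesis by (simp add: Lp_fun_def)
qed

lemma Lp_diff_class:
  assumes p: "1 \<le> p" and f: "f \<in> Lp_fun M p" and g: "g \<in> Lp_fun M p"
  shows "Lp_diff M p (Lp_rel M p `` {f}) (Lp_rel M p `` {g}) = Lp_rel M p `` {\<lambda>x. f x - g x}"
proof -
  have "congruent2 (Lp_rel M p) (Lp_rel M p) (\<lambda>f g. Lp_rel M p `` {\<lambda>x. f x - g x})"
  proof (rule congruent2I')
    fix f f' g g' assume *: "(f, f') \<in> Lp_rel M p" "(g, g') \<in> Lp_rel M p"
    then have "AE x in M. f x = f' x" "AE x in M. g x = g' x"
      by (auto simp: Lp_rel_def)
    then have "AE x in M. f x - g x = f' x - g' x"
      by eventually_elim simp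
    then have "(\<lambda>x. f x - g x, \<lambda>x. f' x - g' x) \<in> Lp_rel M p"
      using * Lp_fun_diff[OF p] by (auto simp: Lp_rel_def)
    then show "Lp_rel M p `` {\<lambda>x. f x - g x} = Lp_rel M p `` {\<lambda>x. f' x - g' x}"
      by (rule equiv_class_eq[OF equiv_Lp_rel])
  qed
  from UN_equiv_class2[OF equiv_Lp_rel equiv_Lp_rel this f g]
  show ?thesis by (simp add: Lp_diff_def)
qed

lemma distr_shift:
  fixes M :: "'a::{topological_group_add, second_countable_topology, t2_space} measure"
  assumes M: "right_Haar_measure M"
  shows "(\<lambda>x. x - a) \<in> measurable M M" and "distr M M (\<lambda>x. x - a) = M"
proof -
  have sets: "sets M = sets borel" using M by (simp add: right_Haar_measure_def)
  then have sp: "space M = UNIV" using sets_eq_imp_space_eq by fastforce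
  have "(\<lambda>x::'a. x - a) \<in> borel_measurable borel"
    by (intro borel_measurable_continuous_onI continuous_intros)
  then show m: "(\<lambda>x. x - a) \<in> measurable M M"
    using sets by (simp cong: measurable_cong_sets)
  show "distr M M (\<lambda>x. x - a) = M"
  proof (rule measure_eqI)
    fix A assume "A \<in> sets (distr M M (\<lambda>x. x - a))"
    then have A: "A \<in> sets M" by simp
    have "(\<lambda>x. x - a) -` A = (\<lambda>x. x + a) ` A"
    proof (intro equalityI subsetI)
      fix x assume "x \<in> (\<lambda>x. x - a) -` A"
      then show "x \<in> (\<lambda>x. x + a) ` A" by (intro image_eqI[of _ _ "x - a"]) auto
    qed auto
    then show "emeasure (distr M M (\<lambda>x. x - a)) A = emeasure M A"
      using M A m sets sp by (simp add: emeasure_distr right_Haar_measure_def)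
  qed simp
qed

lemma wtrans_fun_Lp:
  fixes M :: "'a::{topological_group_add, second_countable_topology, t2_space} measure"
  assumes M: "right_Haar_measure M" and p: "1 \<le> p" and w: "weight w" and f: "f \<in> Lp_fun M p"
    and C: "\<And>x. w x \<le> C"
  shows "wtrans_fun a w f \<in> Lp_fun M p"
    and "Lp_fnorm M p (wtrans_fun a w f) \<le> C * Lp_fnorm M p f"
proof -
  have sets: "sets M = sets borel" using M by (simp add: right_Haar_measure_def)
  have wpos: "0 < w x" for x using w by (simp add: weight_def)
  have C0: "0 < C" using wpos C less_le_trans by blast
  have [measurable]: "w \<in> borel_measurable M"
    using w sets
    by (simp add: weight_def borel_measurable_continuous_onI cong: measurable_cong_sets)
  have [measurable]: "f \<in> borel_measurable M"
    and int: "integrable M (\<lambda>x. norm (f x) powr p)"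
    using f by (auto simp: Lp_fun_def)
  note [measurable] = distr_shift(1)[OF M, of a]
  have int': "integrable M (\<lambda>x. norm (f (x - a)) powr p)"
    using int integrable_distr[OF distr_shift(1)[OF M, of a], of "\<lambda>x. norm (f x) powr p"]
    by (simp add: distr_shift(2)[OF M])
  have eq: "(LINT x|M. norm (f (x - a)) powr p) = (LINT x|M. norm (f x) powr p)"
    using integral_distr[OF distr_shift(1)[OF M, of a], of "\<lambda>x. norm (f x) powr p"]
    by (simp add: distr_shift(2)[OF M])
  have le: "norm (wtrans_fun a w f x) powr p \<le> C powr p * norm (f (x - a)) powr p" for x
  proof -
    have "norm (wtrans_fun a w f x) = w x * norm (f (x - a))"
      using wpos[of x] by (simp add: wtrans_fun_def translation_def norm_mult)
    also have "\<dots> powr p \<le> (C * norm (f (x - a))) powr p"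
      using p C[of x] wpos[of x] by (intro powr_mono2 mult_right_mono) auto
    finally show ?thesis by (simp add: powr_mult)
  qed
  have [measurable]: "wtrans_fun a w f \<in> borel_measurable M"
    unfolding wtrans_fun_def translation_def by measurable
  have int2: "integrable M (\<lambda>x. norm (wtrans_fun a w f x) powr p)"
    by (rule Bochner_Integration.integrable_bound[where
          f = "\<lambda>x. C powr p * norm (f (x - a)) powr p"])
       (use int' le in \<open>auto simp del: powr_eq_0_iff\<close>)
  show "wtrans_fun a w f \<in> Lp_fun M p"
    using int2 by (simp add: Lp_fun_def)
  have "(LINT x|M. norm (wtrans_fun a w f x) powr p)
      \<le> (LINT x|M. C powr p * norm (f (x - a)) powr p)"
    using int2 int' le by (intro integral_mono) auto
  also have "\<dots> = C powr p * (LINT x|M. norm (f x) powr p)"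
    by (simp add: eq)
  finally have "Lp_fnorm M p (wtrans_fun a w f)
      \<le> (C powr p * (LINT x|M. norm (f x) powr p)) powr (1 / p)"
    using p unfolding Lp_fnorm_def by (intro powr_mono2) auto
  also have "\<dots> = C * Lp_fnorm M p f"
    using p C0 by (simp add: Lp_fnorm_def powr_mult powr_powr)
  finally show "Lp_fnorm M p (wtrans_fun a w f) \<le> C * Lp_fnorm M p f" .
qed

lemma weighted_translation_class:
  fixes M :: "'a::{topological_group_add, second_countable_topology, t2_space} measure"
  assumes M: "right_Haar_measure M" and p: "1 \<le> p" and w: "weight w" and f: "f \<in> Lp_fun M p"
  shows "weighted_translation M p a w (Lp_rel M p `` {f}) = Lp_rel M p `` {wtrans_fun a w f}"
proof -
  obtain C where C: "\<And>x. w x \<le> C"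
    using w unfolding weight_def bounded_iff by (auto simp: abs_le_iff)
  have "(\<lambda>f. Lp_rel M p `` {wtrans_fun a w f}) respects Lp_rel M p"
  proof (rule congruentI)
    fix f g assume fg: "(f, g) \<in> Lp_rel M p"
    then have "AE x in M. f x = g x" by (simp add: Lp_rel_def)
    then have "AE x in distr M M (\<lambda>x. x - a). f x = g x"
      by (subst distr_shift(2)[OF M])
    then have "AE x in M. f (x - a) = g (x - a)"
      by (rule AE_distrD[OF distr_shift(1)[OF M]])
    then have "AE x in M. wtrans_fun a w f x = wtrans_fun a w g x"
      by eventually_elim (simp add: wtrans_fun_def translation_def)
    then have "(wtrans_fun a w f, wtrans_fun a w g) \<in> Lp_rel M p"
      using fg wtrans_fun_Lp(1)[OF M p w _ C] by (auto simp: Lp_rel_def)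
    then show "Lp_rel M p `` {wtrans_fun a w f} = Lp_rel M p `` {wtrans_fun a w g}"
      by (rule equiv_class_eq[OF equiv_Lp_rel])
  qed
  from UN_equiv_class[OF equiv_Lp_rel this f] show ?thesis
    by (simp add: weighted_translation_def)
qed

end

theory Submission
  imports Defs
begin

text \<open>
  Write \<open>T\<close> for the weighted translation.  Right invariance of the measure gives
  \<open>\<parallel>T^n f\<parallel>^p = \<integral> \<phi>_n^p \<bar>f\<bar>^p\<close> (\<open>nn_integral_wtrans_power\<close>), so the norms along an orbit
  depend only on the density \<open>v = \<bar>f\<bar>^p\<close>, and their \<open>p\<close>-th powers depend on it linearly.
  All densities are nonnegative, hence nothing ever cancels.  The argument takes place in the cone of
  real sequences \<open>n \<mapsto> \<integral> \<phi>_n^p v\<close> (\<open>orbit_powers\<close>), which is closed under shifts,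
  positive multiples and convergent sums.

  It is enough to find one sequence \<open>s\<close> in the cone that takes arbitrarily small values on a
  set of upper density \<open>1\<close> and arbitrarily large values on a set of upper density \<open>1\<close>.  If it
  belongs to \<open>f\<close>, any two distinct real multiples \<open>c f\<close> and \<open>d f\<close> have, at time \<open>n\<close>, the distance
  \<open>\<bar>c - d\<bar> s(n)^(1/p)\<close>, so the line through \<open>f\<close> is the required uncountable set.

  The criterion gives sequences with arbitrarily small start that are at least \<open>1\<close> on a fixed
  positive fraction \<open>\<delta>\<close> of some interval \<open>{1..N}\<close> and tend to \<open>0\<close> along \<open>A\<close>: put small
  masses near the points \<open>g_n\<close> for \<open>n\<close> in a far piece of \<open>B\<close> (\<open>orbit_powers_seed\<close>).  The
  fraction \<open>\<delta>\<close> is raised to a fraction close to \<open>1\<close> by starting later: by a pigeonhole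
  argument over geometric levels, some shift of the sequence starts low and is high during most
  of an interval (\<open>steep_dense_run\<close>).  Summing such sequences, each chosen much smaller
  than the previous ones require, gives \<open>s\<close> (\<open>irregular_element\<close>).
\<close>

section \<open>Density and dense runs\<close>

text \<open>
  A finite initial segment has density \<open>0\<close>, so a set of upper density above \<open>c\<close> still
  fills more than the fraction \<open>c\<close> of arbitrarily long intervals after its elements below
  \<open>m\<close> are discarded.
\<close>

lemma card_tail_of_upper_dens:
  fixes c :: real
  assumes "ereal c < upper_dens A"
  shows "\<exists>n\<ge>k. 1 \<le> n \<and> c * real n < real (card (A \<inter> {m..n}))"
proof -
  obtain c' where c': "ereal c < ereal c'" "ereal c' < upper_dens A"
    using ereal_dense2[OF assms] by blast
  have cc: "0 < c' - c" using c'(1) by simp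
  have freq: "\<exists>\<^sub>F n in sequentially. ereal c' < ereal (real (card (A \<inter> {1..n})) / real n)"
  proof (rule ccontr)
    assume "\<not> ?thesis"
    then have "\<forall>\<^sub>F n in sequentially. ereal (real (card (A \<inter> {1..n})) / real n) \<le> ereal c'"
      by (simp add: not_frequently not_less)
    then have "upper_dens A \<le> ereal c'" unfolding upper_dens_def by (rule Limsup_bounded)
    then show False using c'(2) by simp
  qed
  obtain n1 :: nat where n1: "real m / (c' - c) \<le> real n1" using real_arch_simple by blast
  obtain n where n: "max (Suc k) n1 \<le> n" "ereal c' < ereal (real (card (A \<inter> {1..n})) / real n)"
    using freq unfolding frequently_sequentially by blast
  have n': "real m / (c' - c) \<le> real n" "k \<le> n" "1 \<le> n" using n(1) n1 by auto
  have "A \<inter> {1..n} \<subseteq> (A \<inter> {m..n}) \<union> {1..m}" by auto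
  then have "card (A \<inter> {1..n}) \<le> card ((A \<inter> {m..n}) \<union> {1..m})" by (intro card_mono) auto
  also have "\<dots> \<le> card (A \<inter> {m..n}) + m" using card_Un_le[of "A \<inter> {m..n}" "{1..m}"] by simp
  finally have "real (card (A \<inter> {1..n})) \<le> real (card (A \<inter> {m..n})) + real m" by linarith
  moreover have "c' * real n < real (card (A \<inter> {1..n}))"
    using n(2) n'(3) by (simp add: field_simps)
  moreover have "real m \<le> (c' - c) * real n"
    using n'(1) cc by (simp add: field_simps)
  ultimately have "c * real n < real (card (A \<inter> {m..n}))" by (simp add: algebra_simps)
  with n' show ?thesis by blast
qed

lemma upper_dens_eq_1I:
  assumes "\<And>k. \<exists>n\<ge>k. 1 \<le> n \<and> (1 - 1 / real (Suc k)) * real n \<le> real (card (A \<inter> {1..n}))"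
  shows "upper_dens A = 1"
proof (rule antisym)
  let ?q = "\<lambda>n. real (card (A \<inter> {1..n})) / real n"
  have "?q n \<le> 1" for n
  proof -
    have "card (A \<inter> {1..n}) \<le> card {1..n}" by (intro card_mono) auto
    then show ?thesis by (simp add: divide_le_eq)
  qed
  then show "upper_dens A \<le> 1"
    unfolding upper_dens_def by (intro Limsup_bounded always_eventually) (simp add: one_ereal_def)
  show "1 \<le> upper_dens A"
  proof (rule ccontr)
    assume "\<not> 1 \<le> upper_dens A"
    then obtain r :: real where r: "upper_dens A < ereal r" "ereal r < 1"
      using ereal_dense2[of "upper_dens A" 1] not_le by blast
    then have r1: "r < 1" by (simp add: one_ereal_def)
    have "\<forall>\<^sub>F n in sequentially. ?q n < r"
      using Limsup_lessD[OF r(1)[unfolded upper_dens_def]] by simp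
    then obtain n0 where n0: "\<And>n. n0 \<le> n \<Longrightarrow> ?q n < r"
      unfolding eventually_sequentially by blast
    obtain j where j: "1 / real (Suc j) < 1 - r" using r1 reals_Archimedean[of "1 - r"]
      by (auto simp: inverse_eq_divide)
    obtain n where n: "max n0 j \<le> n" "1 \<le> n"
      "(1 - 1 / real (Suc (max n0 j))) * real n \<le> real (card (A \<inter> {1..n}))"
      using assms[of "max n0 j"] by blast
    have "1 / real (Suc (max n0 j)) \<le> 1 / real (Suc j)" by (intro divide_left_mono) auto
    then have "r < 1 - 1 / real (Suc (max n0 j))" using j by linarith
    also have "\<dots> \<le> ?q n" using n by (simp add: field_simps)
    finally show False using n0[of n] n by simp
  qed
qed

text \<open>
  The interval \<open>{1..n}\<close> minus the points where \<open>P\<close> fails is a disjoint union of maximal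
  runs of \<open>P\<close>, each preceded by a point where \<open>P\<close> fails (the first one because of
  \<open>\<not> P 0\<close>).  If \<open>Q\<close> holds on the fraction \<open>q\<close> of the union, it holds on the fraction
  \<open>q\<close> of one of the runs.  The induction cuts off the last run.
\<close>

lemma dense_run:
  fixes P Q :: "nat \<Rightarrow> bool" and q :: real
  assumes QP: "\<And>j. Q j \<Longrightarrow> P j" and P0: "\<not> P 0"
    and "0 < card {j \<in> {1..n}. P j}"
    and "q * real (card {j \<in> {1..n}. P j}) \<le> real (card {j \<in> {1..n}. Q j})"
  shows "\<exists>m l. \<not> P m \<and> 1 \<le> l \<and> q * real l \<le> real (card {j \<in> {1..l}. Q (m + j)})"
  using assms(3,4)
proof (induction n rule: less_induct)
  case (less n)
  have n0: "0 < n" using less.prems(1) by (cases n) auto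
  show ?case
  proof (cases "P n")
    case False
    have e: "{1..n} = insert n {1..n - 1}" using n0 by auto
    then have "{j \<in> {1..n}. P j} = {j \<in> {1..n - 1}. P j}" "{j \<in> {1..n}. Q j} = {j \<in> {1..n - 1}. Q j}"
      using False QP by auto
    then show ?thesis using less.IH[of "n - 1"] less.prems n0 by simp
  next
    case True
    define m where "m = (GREATEST j. j \<le> n \<and> \<not> P j)"
    have m: "m \<le> n \<and> \<not> P m" unfolding m_def
      using GreatestI_nat[of "\<lambda>j. j \<le> n \<and> \<not> P j" 0 n] P0 by blast
    have run: "P j" if "m < j" "j \<le> n" for j
      using Greatest_le_nat[of "\<lambda>j. j \<le> n \<and> \<not> P j" j n] that unfolding m_def by force
    have mn: "m < n" using m True by (metis le_neq_implies_less)
    define l where "l = n - m"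
    have split: "card {j \<in> {1..n}. X j} = card {j \<in> {1..m}. X j} + card {j \<in> {1..l}. X (m + j)}"
      for X :: "nat \<Rightarrow> bool"
    proof -
      have "{j \<in> {1..n}. X j} = {j \<in> {1..m}. X j} \<union> (\<lambda>j. m + j) ` {j \<in> {1..l}. X (m + j)}"
      proof (intro equalityI subsetI)
        fix j assume j: "j \<in> {j \<in> {1..n}. X j}"
        show "j \<in> {j \<in> {1..m}. X j} \<union> (\<lambda>j. m + j) ` {j \<in> {1..l}. X (m + j)}"
        proof (cases "j \<le> m")
          case False
          then have "j = m + (j - m)" "j - m \<in> {j \<in> {1..l}. X (m + j)}" using j by (auto simp: l_def)
          then show ?thesis by blast
        qed (use j in auto)
      qed (use mn in \<open>auto simp: l_def\<close>)
      moreover have "{j \<in> {1..m}. X j} \<inter> (\<lambda>j. m + j) ` {j \<in> {1..l}. X (m + j)} = {}" by auto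
      ultimately show ?thesis by (simp add: card_Un_disjoint card_image)
    qed
    have lP: "card {j \<in> {1..l}. P (m + j)} = l"
    proof -
      have "{j \<in> {1..l}. P (m + j)} = {1..l}" using run by (auto simp: l_def)
      then show ?thesis by simp
    qed
    show ?thesis
    proof (cases "q * real l \<le> real (card {j \<in> {1..l}. Q (m + j)})")
      case True
      then show ?thesis using m mn by (intro exI[of _ m] exI[of _ l]) (auto simp: l_def)
    next
      case False
      have le: "q * real (card {j \<in> {1..m}. P j}) < real (card {j \<in> {1..m}. Q j})"
        using less.prems(2) False unfolding split[of P] split[of Q] lP by (simp add: algebra_simps)
      have "card {j \<in> {1..m}. Q j} \<le> card {j \<in> {1..m}. P j}"
        using QP by (intro card_mono) auto
      then have "0 < card {j \<in> {1..m}. P j}" using le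
        by (metis le_zero_eq mult_zero_right of_nat_0 less_irrefl neq0_conv)
      then show ?thesis using less.IH[OF mn] le by simp
    qed
  qed
qed

text \<open>
  This is what raises a positive density to a density close to \<open>1\<close>.  Suppose \<open>s\<close> starts below
  \<open>1 / R ^ r\<close> and is at least \<open>1\<close> on the fraction \<open>\<delta>\<close> of an interval.  Among the levels
  \<open>R ^ i / R ^ r\<close> with \<open>i = 0, \<dots>, r\<close>, the number of times spent above a level cannot drop by
  the factor \<open>q\<close> at each of the \<open>r\<close> steps, as that would leave only the fraction
  \<open>q ^ r < \<delta>\<close> above level \<open>1\<close>.  So there are consecutive levels \<open>t\<close> and \<open>R t\<close> such
  that most of the time above \<open>t\<close> is spent even above \<open>R t\<close>, and \<open>dense_run\<close> finds one run
  above \<open>t\<close>, started from below \<open>t\<close>, on which this is so.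
\<close>

lemma steep_dense_run:
  fixes s :: "nat \<Rightarrow> real"
  assumes q: "0 < q" and R: "1 < R" and r: "q ^ r < \<delta>" and N: "1 \<le> N"
    and s0: "s 0 < 1 / R ^ r" and dense: "\<delta> * real N \<le> real (card {j \<in> {1..N}. 1 \<le> s j})"
  shows "\<exists>t>0. \<exists>m l. 1 \<le> l \<and> s m < t \<and> q * real l \<le> real (card {j \<in> {1..l}. R * t \<le> s (m + j)})"
proof -
  define t where "t i = R ^ i / R ^ r" for i
  define c where "c i = card {j \<in> {1..N}. t i \<le> s j}" for i
  have t_pos: "0 < t i" for i using R by (simp add: t_def)
  have t_Suc: "t (Suc i) = R * t i" for i by (simp add: t_def)
  have t_mono: "t i \<le> t k" if "i \<le> k" for i k
    using that R by (simp add: t_def divide_right_mono power_increasing)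
  have c_mono: "c k \<le> c i" if "i \<le> k" for i k
    unfolding c_def using t_mono[OF that] by (intro card_mono) auto
  have cr: "\<delta> * real N \<le> real (c r)" using dense R by (simp add: c_def t_def)
  have "0 < q ^ r * real N" using q N by simp
  also have "\<dots> < \<delta> * real N" using r N by simp
  also note cr
  finally have cr0: "0 < c r" by simp
  have "\<exists>i<r. q * real (c i) \<le> real (c (Suc i))"
  proof (rule ccontr)
    assume "\<not> ?thesis"
    then have H: "real (c (Suc i)) < q * real (c i)" if "i < r" for i using that by force
    have "real (c i) \<le> q ^ i * real N" if "i \<le> r" for i
      using that
    proof (induction i)
      case 0
      have "c 0 \<le> card {1..N}" unfolding c_def by (intro card_mono) auto
      then show ?case by simp
    next
      case (Suc i)
      have "real (c (Suc i)) \<le> q * real (c i)" using H[of i] Suc.prems by simp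
      also have "\<dots> \<le> q * (q ^ i * real N)" using Suc q by (intro mult_left_mono) auto
      finally show ?case by simp
    qed
    from this[of r] have "real (c r) \<le> q ^ r * real N" by simp
    also have "\<dots> < \<delta> * real N" using r N by simp
    finally show False using cr by simp
  qed
  then obtain i where i: "i < r" "q * real (c i) \<le> real (c (Suc i))" by blast
  have "\<not> t i \<le> s 0" using s0 t_mono[of 0 i] by (simp add: t_def)
  moreover have "0 < c i" using cr0 c_mono[of i r] i by simp
  moreover have "t i \<le> s j" if "t (Suc i) \<le> s j" for j using that t_mono[of i "Suc i"] by simp
  ultimately obtain m l where "\<not> t i \<le> s m" "1 \<le> l"
      "q * real l \<le> real (card {j \<in> {1..l}. t (Suc i) \<le> s (m + j)})"
    using dense_run[of "\<lambda>j. t (Suc i) \<le> s j" "\<lambda>j. t i \<le> s j" N q] i unfolding c_def by blast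
  then show ?thesis using t_pos[of i] unfolding t_Suc
    by (intro exI[of _ "t i"] conjI exI[of _ m] exI[of _ l]) auto
qed

section \<open>Irregular elements of cones of orbits\<close>

definition null_along :: "nat set \<Rightarrow> (nat \<Rightarrow> real) \<Rightarrow> bool" where
  "null_along A s \<longleftrightarrow> (s \<longlongrightarrow> 0) (inf sequentially (principal A))"

text \<open>
  Stated for arbitrarily long intervals, not as an upper density, because the construction
  below fixes one such interval at each stage.
\<close>

lemma null_along_small_dense:
  assumes A: "upper_dens A = 1" "A \<subseteq> {1..}" and s: "null_along A s" and \<tau>: "0 < \<tau>"
  shows "\<exists>n\<ge>k. 1 \<le> n \<and> (1 - 1 / real (Suc k)) * real n
           \<le> real (card ({j. 1 \<le> j \<and> s j < \<tau>} \<inter> {1..n}))"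
proof -
  have "\<forall>\<^sub>F n in inf sequentially (principal A). s n < \<tau>"
    using s \<tau> unfolding null_along_def by (rule order_tendstoD(2))
  then obtain m where m: "\<And>n. m \<le> n \<Longrightarrow> n \<in> A \<Longrightarrow> s n < \<tau>"
    unfolding eventually_inf_principal eventually_sequentially by blast
  have "ereal (1 - 1 / real (Suc k)) < upper_dens A"
    unfolding A(1) one_ereal_def by simp
  then obtain n where n: "k \<le> n" "1 \<le> n"
      "(1 - 1 / real (Suc k)) * real n < real (card (A \<inter> {m..n}))"
    using card_tail_of_upper_dens by blast
  have "card (A \<inter> {m..n}) \<le> card ({j. 1 \<le> j \<and> s j < \<tau>} \<inter> {1..n})"
    using m A(2) by (intro card_mono) auto
  then have "real (card (A \<inter> {m..n})) \<le> real (card ({j. 1 \<le> j \<and> s j < \<tau>} \<inter> {1..n}))"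
    by simp
  with n show ?thesis by (meson order_trans less_imp_le)
qed

text \<open>
  The properties of the sequences \<open>n \<mapsto> \<parallel>T^n f\<parallel>^p\<close> of a positive weighted translation that
  the construction of a chaotic orbit needs.  Closure under \<open>shift\<close> is the passage from \<open>f\<close>
  to \<open>T f\<close>; closure under infinite sums is completeness of the space together with the fact
  that \<open>p\<close>-th powers of norms can be added exactly (replace \<open>f\<close> and \<open>g\<close> by
  \<open>(f^p + g^p)^(1/p)\<close>).
\<close>

locale orbit_cone =
  fixes S :: "(nat \<Rightarrow> real) set" and C :: real
  assumes C: "1 \<le> C"
    and nonneg: "s \<in> S \<Longrightarrow> 0 \<le> s n"
    and growth: "s \<in> S \<Longrightarrow> s (Suc n) \<le> C * s n"
    and scale: "s \<in> S \<Longrightarrow> 0 \<le> c \<Longrightarrow> (\<lambda>n. c * s n) \<in> S"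
    and shift: "s \<in> S \<Longrightarrow> (\<lambda>n. s (Suc n)) \<in> S"
    and suminf_closed: "(\<And>k. \<sigma> k \<in> S) \<Longrightarrow> (\<And>n. summable (\<lambda>k. \<sigma> k n)) \<Longrightarrow> (\<lambda>n. \<Sum>k. \<sigma> k n) \<in> S"
begin

lemma growth_power: "s \<in> S \<Longrightarrow> s (n + m) \<le> C ^ m * s n"
proof (induction m)
  case (Suc m)
  have "s (n + Suc m) \<le> C * s (n + m)" using growth[OF Suc.prems, of "n + m"] by simp
  also have "\<dots> \<le> C * (C ^ m * s n)" using Suc C by (intro mult_left_mono) auto
  finally show ?case by (simp add: mult.assoc)
qed simp

lemma shift_power: "s \<in> S \<Longrightarrow> (\<lambda>n. s (m + n)) \<in> S"
proof (induction m)
  case (Suc m)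
  from shift[OF Suc.IH[OF Suc.prems]] show ?case by simp
qed simp

lemma null_along_shift:
  assumes "s \<in> S" "null_along A s"
  shows "null_along A (\<lambda>n. s (m + n))"
  unfolding null_along_def
proof (rule tendsto_sandwich)
  show "\<forall>\<^sub>F n in inf sequentially (principal A). 0 \<le> s (m + n)"
    by (intro always_eventually allI nonneg[OF assms(1)])
  show "\<forall>\<^sub>F n in inf sequentially (principal A). s (m + n) \<le> C ^ m * s n"
    using growth_power[OF assms(1), of _ m] by (intro always_eventually allI) (simp add: add.commute)
  show "((\<lambda>n. C ^ m * s n) \<longlongrightarrow> 0) (inf sequentially (principal A))"
    using assms(2) unfolding null_along_def by (rule tendsto_mult_right_zero)
qed simp

text \<open>
  Starting a seed orbit at the beginning of the run found by \<open>steep_dense_run\<close> and rescaling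
  gives a sequence that starts as low and climbs as high as desired, and stays high for the
  fraction \<open>q\<close> of an interval \<open>{1..l}\<close>.  The length of that interval comes for free: since
  each step multiplies by at most \<open>C\<close>, a climb from below \<open>K / C ^ k\<close> to \<open>K\<close> takes more than
  \<open>k\<close> steps.
\<close>

lemma steep_dense_element:
  assumes \<delta>: "0 < \<delta>"
    and seed: "\<And>\<eta>. 0 < \<eta> \<Longrightarrow> \<exists>s\<in>S. s 0 < \<eta> \<and> null_along A s \<and>
                 (\<exists>N\<ge>1. \<delta> * real N \<le> real (card {j \<in> {1..N}. 1 \<le> s j}))"
    and \<eta>: "0 < \<eta>" and K: "0 < K" and q: "0 < q" "q < 1"
  shows "\<exists>s\<in>S. s 0 < \<eta> \<and> null_along A s \<and>
           (\<exists>l\<ge>k. 1 \<le> l \<and> q * real l \<le> real (card {j \<in> {1..l}. K \<le> s j}))"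
proof -
  define \<eta>' where "\<eta>' = min \<eta> (K / C ^ k)"
  have \<eta>': "0 < \<eta>'" using \<eta> K C by (simp add: \<eta>'_def)
  define R where "R = max 2 (K / \<eta>')"
  have R: "1 < R" "K / \<eta>' \<le> R" by (auto simp: R_def)
  then have KR: "K / R \<le> \<eta>'" using \<eta>' by (simp add: field_simps)
  obtain r where r: "q ^ r < \<delta>" using real_arch_pow_inv[OF \<delta> q(2)] by blast
  obtain s N where s: "s \<in> S" "s 0 < 1 / R ^ r" "null_along A s"
    and N: "1 \<le> N" "\<delta> * real N \<le> real (card {j \<in> {1..N}. 1 \<le> s j})"
    using seed[of "1 / R ^ r"] R by auto
  obtain t m l where t: "0 < t" and l: "1 \<le> l" and sm: "s m < t"
    and run: "q * real l \<le> real (card {j \<in> {1..l}. R * t \<le> s (m + j)})"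
    using steep_dense_run[OF q(1) R(1) r N(1) s(2) N(2)] by blast
  define c where "c = K / (R * t)"
  define s' where "s' j = c * s (m + j)" for j
  have c: "0 < c" using K R t by (simp add: c_def)
  have s': "s' \<in> S" unfolding s'_def using c by (intro scale shift_power s(1)) simp
  have "s' 0 < c * t" using sm c by (simp add: s'_def)
  also have "c * t = K / R" using t by (simp add: c_def)
  finally have s'0: "s' 0 < \<eta>'" using KR by simp
  have null: "null_along A s'"
    using null_along_shift[OF s(1,3), of m] unfolding null_along_def s'_def
    by (rule tendsto_mult_right_zero)
  have iff: "R * t \<le> s (m + j) \<longleftrightarrow> K \<le> s' j" for j
    using R t K by (simp add: s'_def c_def field_simps)
  have run': "q * real l \<le> real (card {j \<in> {1..l}. K \<le> s' j})" using run unfolding iff .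
  have "0 < q * real l" using q l by simp
  with run' have "{j \<in> {1..l}. K \<le> s' j} \<noteq> {}" by (metis card.empty not_le of_nat_0)
  then obtain j where j: "j \<le> l" "K \<le> s' j" by auto
  note j(2)
  also have "s' j \<le> C ^ j * s' 0" using growth_power[OF s', of 0 j] by simp
  also have "\<dots> < C ^ j * \<eta>'" using s'0 C by simp
  also have "\<dots> \<le> C ^ j * (K / C ^ k)" using C by (intro mult_left_mono) (auto simp: \<eta>'_def)
  finally have "C ^ k < C ^ j" using K C by (simp add: field_simps)
  then have "k < j" using C by (meson not_le power_increasing)
  then show ?thesis
    using s' s'0 null l run' j(1) by (intro bexI[of _ s'] conjI exI[of _ l]) (auto simp: \<eta>'_def)
qed

text \<open>
  Gliding hump.  The element is a sum of pieces \<open>s k\<close>.  The \<open>k\<close>-th piece is at least \<open>k\<close> on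
  most of a long interval, and so is the sum, because the pieces are nonnegative and cannot
  cancel.  The partial sums tend to \<open>0\<close> along \<open>A\<close>, so each partial sum is small on most of a
  long interval \<open>{1..e}\<close>; the later pieces start so low (below a multiple of \<open>1 / C ^ e\<close>) that
  they stay negligible up to time \<open>e\<close>.
\<close>

lemma irregular_element:
  assumes A: "upper_dens A = 1" "A \<subseteq> {1..}" and \<delta>: "0 < \<delta>"
    and seed: "\<And>\<eta>. 0 < \<eta> \<Longrightarrow> \<exists>s\<in>S. s 0 < \<eta> \<and> null_along A s \<and>
                 (\<exists>N\<ge>1. \<delta> * real N \<le> real (card {j \<in> {1..N}. 1 \<le> s j}))"
  obtains x where "x \<in> S" "\<And>\<tau>. 0 < \<tau> \<Longrightarrow> upper_dens {n. 1 \<le> n \<and> x n < \<tau>} = 1"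
    "\<And>K. upper_dens {n. 1 \<le> n \<and> K \<le> x n} = 1"
proof -
  define small where "small k \<sigma> e \<longleftrightarrow> (1 - 1 / real (Suc k)) * real e
      \<le> real (card ({j. 1 \<le> j \<and> \<sigma> j < 1 / real (Suc k)} \<inter> {1..e}))" for k e and \<sigma> :: "nat \<Rightarrow> real"
  define large where "large k s l \<longleftrightarrow> (1 - 1 / real (Suc k)) * real l
      \<le> real (card ({j. 1 \<le> j \<and> real k \<le> s j} \<inter> {1..l}))" for k l and s :: "nat \<Rightarrow> real"
  \<comment> \<open>The state of the recursion is the pair of the partial sum of the pieces chosen so far
    and the end of an interval on which this partial sum is mostly small.\<close>
  define P where "P k y \<longleftrightarrow> null_along A (fst y) \<and> k \<le> snd y \<and> 1 \<le> snd y \<and> small k (fst y) (snd y)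
      \<and> (k = 0 \<longrightarrow> fst y = (\<lambda>_. 0))" for k and y :: "(nat \<Rightarrow> real) \<times> nat"
  define Q where "Q k y y' \<longleftrightarrow> snd y \<le> snd y' \<and> (\<exists>s\<in>S. fst y' = (\<lambda>n. fst y n + s n) \<and>
      s 0 < (1 / 2) ^ k / C ^ snd y \<and> (\<exists>l\<ge>k. 1 \<le> l \<and> large k s l))"
    for k and y y' :: "(nat \<Rightarrow> real) \<times> nat"
  have ex_small: "\<exists>e\<ge>m. 1 \<le> e \<and> small k \<sigma> e" if null: "null_along A \<sigma>" for \<sigma> k m
  proof -
    obtain e where e: "max k m \<le> e" "1 \<le> e" "(1 - 1 / real (Suc (max k m))) * real e
           \<le> real (card ({j. 1 \<le> j \<and> \<sigma> j < 1 / real (Suc k)} \<inter> {1..e}))"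
      using null_along_small_dense[OF A null, of "1 / real (Suc k)" "max k m"] by auto
    have "1 / real (Suc (max k m)) \<le> 1 / real (Suc k)" by (intro divide_left_mono) auto
    then have "(1 - 1 / real (Suc k)) * real e \<le> (1 - 1 / real (Suc (max k m))) * real e"
      by (intro mult_right_mono) auto
    then have "small k \<sigma> e" using e(3) unfolding small_def by (rule order_trans)
    with e(1,2) show ?thesis by (intro exI[of _ e]) simp
  qed
  have ex_large: "\<exists>s\<in>S. s 0 < \<eta> \<and> null_along A s \<and> (\<exists>l\<ge>k. 1 \<le> l \<and> large k s l)" if \<eta>: "0 < \<eta>" for \<eta> k
  proof -
    \<comment> \<open>The shifts by one avoid the degenerate values q = 0 and K = 0 at k = 0.\<close>
    let ?q = "1 - 1 / real (Suc (Suc k))"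
    obtain s l where s: "s \<in> S" "s 0 < \<eta>" "null_along A s" and l: "k \<le> l" "1 \<le> l"
      "?q * real l \<le> real (card {j \<in> {1..l}. real (Suc k) \<le> s j})"
      using steep_dense_element[OF \<delta> seed \<eta>, where K = "real (Suc k)" and q = ?q and k = k]
      by auto
    have "1 / real (Suc (Suc k)) \<le> 1 / real (Suc k)" by (intro divide_left_mono) auto
    then have "(1 - 1 / real (Suc k)) * real l \<le> ?q * real l"
      by (intro mult_right_mono) auto
    also note l(3)
    also have "real (card {j \<in> {1..l}. real (Suc k) \<le> s j})
        \<le> real (card ({j. 1 \<le> j \<and> real k \<le> s j} \<inter> {1..l}))"
      unfolding of_nat_le_iff by (intro card_mono) auto
    finally have "large k s l" unfolding large_def .
    with s l show ?thesis by blast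
  qed
  have "\<exists>y. P 0 y"
  proof -
    have null: "null_along A (\<lambda>_. 0)" by (simp add: null_along_def)
    then obtain e where "1 \<le> e" "small 0 (\<lambda>_. 0) e" using ex_small by blast
    with null show ?thesis by (intro exI[of _ "(\<lambda>_. 0, e)"]) (simp add: P_def)
  qed
  moreover have "\<exists>y'. P (Suc k) y' \<and> Q k y y'" if "P k y" for k y
  proof -
    have "0 < (1 / 2) ^ k / C ^ snd y" using C by simp
    then obtain s l where s: "s \<in> S" "s 0 < (1 / 2) ^ k / C ^ snd y" "null_along A s"
      and l: "k \<le> l" "1 \<le> l" "large k s l" using ex_large by blast
    define \<sigma> where "\<sigma> = (\<lambda>n. fst y n + s n)"
    have \<sigma>: "null_along A \<sigma>"
      using s(3) that tendsto_add_zero unfolding \<sigma>_def null_along_def P_def by blast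
    obtain e where e: "max (Suc k) (snd y) \<le> e" "1 \<le> e" "small (Suc k) \<sigma> e"
      using ex_small[OF \<sigma>] by blast
    have "P (Suc k) (\<sigma>, e)" using \<sigma> e by (simp add: P_def)
    moreover have "Q k y (\<sigma>, e)" using s l e unfolding Q_def \<sigma>_def by auto
    ultimately show ?thesis by blast
  qed
  ultimately obtain Y where Y: "\<And>k. P k (Y k)" "\<And>k. Q k (Y k) (Y (Suc k))"
    using dependent_nat_choice[of P Q] by blast
  define \<sigma> e where "\<sigma> k = fst (Y k)" and "e k = snd (Y k)" for k
  have "\<exists>s. s \<in> S \<and> \<sigma> (Suc k) = (\<lambda>n. \<sigma> k n + s n) \<and> s 0 < (1 / 2) ^ k / C ^ e k \<and>
      (\<exists>l\<ge>k. 1 \<le> l \<and> large k s l)" for k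
    using Y(2)[of k] unfolding Q_def \<sigma>_def e_def by blast
  then obtain s where s: "\<And>k. s k \<in> S" "\<And>k. \<sigma> (Suc k) = (\<lambda>n. \<sigma> k n + s k n)"
      "\<And>k. s k 0 < (1 / 2) ^ k / C ^ e k" "\<And>k. \<exists>l\<ge>k. 1 \<le> l \<and> large k (s k) l"
    by metis
  have e: "k \<le> e k" "1 \<le> e k" "small k (\<sigma> k) (e k)" for k
    using Y(1)[of k] by (simp_all add: P_def e_def \<sigma>_def)
  have e_mono: "e i \<le> e k" if "i \<le> k" for i k
    using that by (rule lift_Suc_mono_le[rotated]) (use Y(2) in \<open>simp add: Q_def e_def\<close>)
  have \<sigma>: "\<sigma> k n = (\<Sum>i<k. s i n)" for k n
  proof (induction k)
    case 0
    show ?case using Y(1)[of 0] by (simp add: P_def \<sigma>_def)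
  qed (simp add: s(2))
  have bound: "s k n \<le> C ^ n * ((1 / 2) ^ k / C ^ e k)" for k n
  proof -
    have "s k n \<le> C ^ n * s k 0" using growth_power[OF s(1), of k 0 n] by simp
    also have "\<dots> \<le> C ^ n * ((1 / 2) ^ k / C ^ e k)"
      using s(3)[of k] C by (intro mult_left_mono) auto
    finally show ?thesis .
  qed
  have small_tail: "s k n \<le> (1 / 2) ^ k" if "n \<le> e k" for k n
  proof -
    have "C ^ n \<le> C ^ e k" using C that by (intro power_increasing)
    then have "C ^ n * ((1 / 2) ^ k / C ^ e k) \<le> (1 / 2) ^ k" using C by (simp add: field_simps)
    with bound[of k n] show ?thesis by linarith
  qed
  have summ: "summable (\<lambda>k. s k n)" for n
  proof (rule summable_comparison_test')
    show "summable (\<lambda>k. (1 / 2 :: real) ^ k)" by (rule summable_geometric) simp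
    show "norm (s k n) \<le> (1 / 2) ^ k" if "n \<le> k" for k
      using small_tail[of n k] nonneg[OF s(1)] e(1)[of k] that by simp
  qed
  define x where "x n = (\<Sum>k. s k n)" for n
  have x: "x \<in> S" unfolding x_def using s(1) summ by (rule suminf_closed)
  have x_ge: "s k n \<le> x n" for k n
    unfolding x_def using sum_le_suminf[OF summ, of "{k}"] nonneg[OF s(1)] by simp
  have x_le: "x n \<le> \<sigma> k n + 2 / real (Suc k)" if "n \<le> e k" for k n
  proof -
    have "x n = (\<Sum>i. s (i + k) n) + \<sigma> k n"
      unfolding x_def \<sigma> by (rule suminf_split_initial_segment[OF summ])
    moreover have "(\<Sum>i. s (i + k) n) \<le> (\<Sum>i. (1 / 2) ^ k * (1 / 2) ^ i)"
    proof (rule suminf_le)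
      show "s (i + k) n \<le> (1 / 2) ^ k * (1 / 2) ^ i" for i
        using small_tail[of n "i + k"] that e_mono[of k "i + k"]
        by (simp add: power_add mult.commute)
      show "summable (\<lambda>i. s (i + k) n)" using summ by (rule summable_ignore_initial_segment)
      show "summable (\<lambda>i. (1 / 2 :: real) ^ k * (1 / 2) ^ i)"
        by (intro summable_mult summable_geometric) simp
    qed
    moreover have "(\<Sum>i. (1 / 2 :: real) ^ k * (1 / 2) ^ i) = 2 * (1 / 2) ^ k"
      by (subst suminf_mult) (auto simp: suminf_geometric summable_geometric)
    moreover have "(1 / 2 :: real) ^ k \<le> 1 / real (Suc k)"
    proof -
      have "real (Suc k) \<le> 2 ^ k"
        by (metis Suc_leI less_exp of_nat_le_iff of_nat_numeral of_nat_power)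
      then show ?thesis by (simp add: power_one_over divide_left_mono)
    qed
    ultimately show ?thesis by linarith
  qed
  show ?thesis
  proof (rule that[OF x])
    fix \<tau> :: real assume \<tau>: "0 < \<tau>"
    obtain k0 where k0: "inverse (real (Suc k0)) < \<tau> / 3" using reals_Archimedean[of "\<tau> / 3"] \<tau> by auto
    show "upper_dens {n. 1 \<le> n \<and> x n < \<tau>} = 1"
    proof (rule upper_dens_eq_1I)
      fix k
      define k' where "k' = max k k0"
      have "1 / real (Suc k') \<le> 1 / real (Suc k0)" by (intro divide_left_mono) (auto simp: k'_def)
      then have k': "3 / real (Suc k') < \<tau>" using k0 by (simp add: inverse_eq_divide)
      have "1 / real (Suc k') \<le> 1 / real (Suc k)" by (intro divide_left_mono) (auto simp: k'_def)
      then have "(1 - 1 / real (Suc k)) * real (e k') \<le> (1 - 1 / real (Suc k')) * real (e k')"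
        by (intro mult_right_mono) auto
      also have "\<dots> \<le> real (card ({j. 1 \<le> j \<and> \<sigma> k' j < 1 / real (Suc k')} \<inter> {1..e k'}))"
        using e(3)[of k'] by (simp only: small_def)
      also have "\<dots> \<le> real (card ({n. 1 \<le> n \<and> x n < \<tau>} \<inter> {1..e k'}))"
      proof -
        have "x j < \<tau>" if "\<sigma> k' j < 1 / real (Suc k')" "j \<le> e k'" for j
          using x_le[OF that(2)] that(1) k' by simp
        then show ?thesis unfolding of_nat_le_iff by (intro card_mono) auto
      qed
      finally show "\<exists>n\<ge>k. 1 \<le> n \<and> (1 - 1 / real (Suc k)) * real n
          \<le> real (card ({n. 1 \<le> n \<and> x n < \<tau>} \<inter> {1..n}))"
        using e(1,2)[of k'] by (intro exI[of _ "e k'"]) (auto simp: k'_def)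
    qed
  next
    fix K :: real
    obtain k0 :: nat where k0: "K \<le> real k0" using real_arch_simple by blast
    show "upper_dens {n. 1 \<le> n \<and> K \<le> x n} = 1"
    proof (rule upper_dens_eq_1I)
      fix k
      define k' where "k' = max k k0"
      obtain l where l: "k' \<le> l" "1 \<le> l" "large k' (s k') l" using s(4) by blast
      have "1 / real (Suc k') \<le> 1 / real (Suc k)" by (intro divide_left_mono) (auto simp: k'_def)
      then have "(1 - 1 / real (Suc k)) * real l \<le> (1 - 1 / real (Suc k')) * real l"
        by (intro mult_right_mono) auto
      also have "\<dots> \<le> real (card ({j. 1 \<le> j \<and> real k' \<le> s k' j} \<inter> {1..l}))"
        using l(3) by (simp only: large_def)
      also have "\<dots> \<le> real (card ({n. 1 \<le> n \<and> K \<le> x n} \<inter> {1..l}))"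
      proof -
        have "K \<le> x j" if "real k' \<le> s k' j" for j
          using x_ge[of k' j] that k0 by (simp add: k'_def)
        then show ?thesis unfolding of_nat_le_iff by (intro card_mono) auto
      qed
      finally show "\<exists>n\<ge>k. 1 \<le> n \<and> (1 - 1 / real (Suc k)) * real n
          \<le> real (card ({n. 1 \<le> n \<and> K \<le> x n} \<inter> {1..n}))"
        using l by (intro exI[of _ l]) (auto simp: k'_def)
    qed
  qed
qed

end

section \<open>Orbits of weighted translations\<close>

lemma nat_mult_Suc: "nat_mult (Suc n) a = nat_mult n a + a"
  by (simp add: nat_mult_def)

lemma nat_mult_Suc': "nat_mult (Suc n) a = a + nat_mult n a"
proof (induction n)
  case (Suc n)
  have "nat_mult (Suc (Suc n)) a = nat_mult (Suc n) a + a" by (rule nat_mult_Suc)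
  also have "\<dots> = a + (nat_mult n a + a)" unfolding Suc.IH by (rule add.assoc)
  also have "nat_mult n a + a = nat_mult (Suc n) a" by (rule nat_mult_Suc[symmetric])
  finally show ?case .
qed (simp add: nat_mult_def)

lemma phi_0 [simp]: "phi a w 0 x = 1"
  by (simp add: phi_def)

lemma phi_Suc: "phi a w (Suc n) x = phi a w n x * w (x + nat_mult (Suc n) a)"
  by (simp add: phi_def translation_def)

text \<open>
  The other way of splitting off a factor: \<open>phi_Suc\<close> removes the last one, this the first,
  which is the one produced by a single application of the weighted translation.
\<close>

lemma phi_Suc_shift: "phi a w (Suc n) x = w (x + a) * phi a w n (x + a)"
proof (induction n)
  case (Suc n)
  have "phi a w (Suc (Suc n)) x = phi a w (Suc n) x * w (x + nat_mult (Suc (Suc n)) a)"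
    by (rule phi_Suc)
  also have "\<dots> = w (x + a) * (phi a w n (x + a) * w (x + a + nat_mult (Suc n) a))"
    unfolding Suc.IH nat_mult_Suc'[of "Suc n" a] by (simp add: add.assoc mult.assoc)
  also have "phi a w n (x + a) * w (x + a + nat_mult (Suc n) a) = phi a w (Suc n) (x + a)"
    by (rule phi_Suc[symmetric])
  finally show ?case .
qed (simp add: phi_Suc nat_mult_def)

text \<open>
  By the Lindelof property countably many right translates of \<open>V\<close> cover the group; if \<open>V\<close>
  were a null set, so would be the whole group.
\<close>

lemma emeasure_right_Haar_open_pos:
  fixes M :: "'a::{topological_group_add, second_countable_topology} measure"
  assumes M: "right_Haar_measure M" and V: "open V" "V \<noteq> {}"
  shows "0 < emeasure M V"
proof (rule ccontr)
  assume "\<not> 0 < emeasure M V"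
  then have V0: "emeasure M V = 0" by simp
  have sets: "sets M = sets borel" using M by (simp add: right_Haar_measure_def)
  obtain v where v: "v \<in> V" using V(2) by blast
  have "(\<lambda>x. x + h) ` V = (\<lambda>x. x - h) -` V" for h
  proof (intro equalityI subsetI)
    fix x assume "x \<in> (\<lambda>x. x - h) -` V"
    then show "x \<in> (\<lambda>x. x + h) ` V" by (intro image_eqI[of _ _ "x - h"]) auto
  qed auto
  then have op: "open ((\<lambda>x. x + h) ` V)" for h
    using V(1) by (auto intro!: open_vimage continuous_intros)
  have null: "(\<lambda>x. x + h) ` V \<in> null_sets M" for h
  proof
    have "V \<in> sets borel" using V(1) by simp
    then have "emeasure M ((\<lambda>x. x + h) ` V) = emeasure M V"
      using M unfolding right_Haar_measure_def by blast
    then show "emeasure M ((\<lambda>x. x + h) ` V) = 0" using V0 by simp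
    show "(\<lambda>x. x + h) ` V \<in> sets M" using op[of h] by (simp add: sets)
  qed
  obtain \<F> where \<F>: "\<F> \<subseteq> range (\<lambda>h. (\<lambda>x. x + h) ` V)" "countable \<F>"
      "\<Union>\<F> = \<Union>(range (\<lambda>h. (\<lambda>x. x + h) ` V))"
    by (rule Lindelof[of "range (\<lambda>h. (\<lambda>x. x + h) ` V)"]) (use op in auto)
  have "x \<in> (\<lambda>y. y + (- v + x)) ` V" for x
    using v by (intro image_eqI[of _ _ v]) (auto simp: add.assoc[symmetric])
  then have "UNIV = \<Union>\<F>" unfolding \<F>(3) by blast
  also have "\<Union>\<F> \<in> null_sets M"
    using null_sets_UN'[OF \<F>(2), of "\<lambda>X. X" M] \<F>(1) null by auto
  finally show False using M by (simp add: right_Haar_measure_def null_sets_def)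
qed

text \<open>
  Since \<open>\<parallel>T^n f\<parallel>^p\<close> is the integral of \<open>\<phi>_n^p \<bar>f\<bar>^p\<close>, these are the sequences
  \<open>n \<mapsto> \<parallel>T^n f\<parallel>^p\<close> with \<open>\<bar>f\<bar>^p = v\<close>.  The density \<open>v\<close> takes extended values so that
  infinite sums of densities need no convergence argument; taking \<open>n = 0\<close> shows that \<open>v\<close> is
  integrable.
\<close>

definition orbit_powers ::
  "'a::topological_group_add measure \<Rightarrow> real \<Rightarrow> 'a \<Rightarrow> ('a \<Rightarrow> real) \<Rightarrow> (nat \<Rightarrow> real) set" where
  "orbit_powers M p a w = {s. (\<forall>n. 0 \<le> s n) \<and>
     (\<exists>v\<in>borel_measurable M. \<forall>n. (\<integral>\<^sup>+x. ennreal (phi a w n x powr p) * v x \<partial>M) = ennreal (s n))}"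

context
  fixes M :: "'a::{topological_group_add, second_countable_topology, t2_space} measure"
    and p :: real and a :: 'a and w :: "'a \<Rightarrow> real"
  assumes M: "right_Haar_measure M" and p: "1 \<le> p" and w: "weight w"
begin

lemma sets_M: "sets M = sets borel"
  using M by (simp add: right_Haar_measure_def)

lemma space_M: "space M = UNIV"
  using sets_eq_imp_space_eq[OF sets_M] by simp

lemma measurable_M_continuous: "continuous_on UNIV (f :: 'a \<Rightarrow> real) \<Longrightarrow> f \<in> borel_measurable M"
  by (simp add: borel_measurable_continuous_onI sets_M cong: measurable_cong_sets)

lemma phi_pos: "0 < phi a w n x"
  using w by (auto simp: phi_def translation_def weight_def intro!: prod_pos)

lemma continuous_phi: "continuous_on UNIV (phi a w n)"
proof -
  have "continuous_on UNIV (\<lambda>x. w (x - h))" for h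
    using w by (auto simp: weight_def intro!: continuous_on_compose2[of UNIV w] continuous_intros)
  then show ?thesis unfolding phi_def translation_def by (intro continuous_on_prod)
qed

lemma continuous_phi_powr: "continuous_on UNIV (\<lambda>x. phi a w n x powr p)"
  by (intro continuous_on_powr continuous_phi continuous_intros) (use phi_pos in \<open>auto simp: less_imp_neq[symmetric]\<close>)

lemma measurable_phi_powr [measurable]: "(\<lambda>x. phi a w n x powr p) \<in> borel_measurable M"
  by (rule measurable_M_continuous[OF continuous_phi_powr])

lemma measurable_w [measurable]: "w \<in> borel_measurable M"
  using w by (intro measurable_M_continuous) (simp add: weight_def)

lemma weight_bound: "\<exists>C\<ge>1. \<forall>x. w x \<le> C"
proof -
  obtain C where "\<And>x. w x \<le> C"
    using w unfolding weight_def bounded_iff by (auto simp: abs_le_iff)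
  then show ?thesis by (intro exI[of _ "max 1 C"]) (auto intro: max.coboundedI2)
qed

lemma nn_integral_shift:
  assumes [measurable]: "f \<in> borel_measurable M"
  shows "(\<integral>\<^sup>+x. f (x - a) \<partial>M) = (\<integral>\<^sup>+x. f x \<partial>M)"
proof -
  note [measurable] = distr_shift(1)[OF M, of a]
  have "(\<integral>\<^sup>+x. f x \<partial>M) = (\<integral>\<^sup>+x. f x \<partial>distr M M (\<lambda>x. x - a))"
    by (simp only: distr_shift(2)[OF M])
  also have "\<dots> = (\<integral>\<^sup>+x. f (x - a) \<partial>M)" by (rule nn_integral_distr) simp_all
  finally show ?thesis by simp
qed

text \<open>
  The transpose of one step of the dynamics: applying the weighted translation to \<open>f\<close>, which
  turns \<open>v = \<bar>f\<bar>^p\<close> into \<open>w^p v(x - a)\<close>, amounts to replacing \<open>\<phi>_n\<close> by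
  \<open>\<phi>_(n+1)\<close>, by right invariance and \<open>phi_Suc_shift\<close>.
\<close>

lemma nn_integral_phi_shift:
  assumes [measurable]: "v \<in> borel_measurable M"
  shows "(\<integral>\<^sup>+x. ennreal (phi a w n x powr p) * (ennreal (w x powr p) * v (x - a)) \<partial>M)
       = (\<integral>\<^sup>+x. ennreal (phi a w (Suc n) x powr p) * v x \<partial>M)"
proof -
  have "0 \<le> w x" for x using w by (simp add: weight_def less_imp_le)
  then have "phi a w (Suc n) (x - a) powr p = phi a w n x powr p * w x powr p" for x
    using phi_Suc_shift[of a w n "x - a"] phi_pos[of n x]
    by (simp add: powr_mult less_imp_le mult.commute)
  then show ?thesis
    using nn_integral_shift[of "\<lambda>x. ennreal (phi a w (Suc n) x powr p) * v x"]
    by (simp add: ennreal_mult' mult.assoc)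
qed

text \<open>
  At \<open>m = 0\<close> this is the formula for \<open>\<parallel>T^n f\<parallel>^p\<close>; the general \<open>m\<close> serves the induction.
\<close>

lemma nn_integral_wtrans_power:
  assumes [measurable]: "f \<in> borel_measurable M"
  shows "(\<integral>\<^sup>+x. ennreal (phi a w m x powr p) * ennreal (norm ((wtrans_fun a w ^^ n) f x) powr p) \<partial>M)
       = (\<integral>\<^sup>+x. ennreal (phi a w (m + n) x powr p) * ennreal (norm (f x) powr p) \<partial>M)"
proof (induction n arbitrary: m)
  case (Suc n)
  note [measurable] = distr_shift(1)[OF M, of a]
  have meas: "(wtrans_fun a w ^^ n) f \<in> borel_measurable M" for n
  proof (induction n)
    case (Suc n)
    note [measurable] = this
    have "(\<lambda>x. complex_of_real (w x) * (wtrans_fun a w ^^ n) f (x - a)) \<in> borel_measurable M"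
      by measurable
    then show ?case by (simp add: wtrans_fun_def[of a w "(wtrans_fun a w ^^ n) f"] translation_def)
  qed simp
  define v where "v x = ennreal (norm ((wtrans_fun a w ^^ n) f x) powr p)" for x
  have v: "v \<in> borel_measurable M" unfolding v_def using meas[of n] by measurable
  have "ennreal (norm ((wtrans_fun a w ^^ Suc n) f x) powr p) = ennreal (w x powr p) * v (x - a)" for x
  proof -
    have "0 \<le> w x" using w by (simp add: weight_def less_imp_le)
    then show ?thesis
      by (simp add: v_def wtrans_fun_def[of a w "(wtrans_fun a w ^^ n) f"] translation_def norm_mult
          powr_mult ennreal_mult')
  qed
  then have "(\<integral>\<^sup>+x. ennreal (phi a w m x powr p)
        * ennreal (norm ((wtrans_fun a w ^^ Suc n) f x) powr p) \<partial>M)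
      = (\<integral>\<^sup>+x. ennreal (phi a w (Suc m) x powr p) * v x \<partial>M)"
    using nn_integral_phi_shift[OF v, of m] by simp
  also have "\<dots> = (\<integral>\<^sup>+x. ennreal (phi a w (m + Suc n) x powr p) * ennreal (norm (f x) powr p) \<partial>M)"
    using Suc.IH[of "Suc m"] by (simp add: v_def)
  finally show ?case .
qed simp

lemma orbit_cone_orbit_powers:
  assumes C: "1 \<le> C" "\<And>x. w x \<le> C"
  shows "orbit_cone (orbit_powers M p a w) (C powr p)"
proof
  show "1 \<le> C powr p" using C(1) p by (simp add: ge_one_powr_ge_zero)
next
  fix s n assume "s \<in> orbit_powers M p a w"
  then show "0 \<le> s n" by (simp add: orbit_powers_def)
next
  fix s n assume "s \<in> orbit_powers M p a w"
  then obtain v where s0: "\<And>n. 0 \<le> s n" and v[measurable]: "v \<in> borel_measurable M"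
    and s: "\<And>n. (\<integral>\<^sup>+x. ennreal (phi a w n x powr p) * v x \<partial>M) = ennreal (s n)"
    by (auto simp: orbit_powers_def)
  have "ennreal (s (Suc n)) \<le> (\<integral>\<^sup>+x. ennreal (C powr p) * (ennreal (phi a w n x powr p) * v x) \<partial>M)"
    unfolding s[symmetric]
  proof (rule nn_integral_mono)
    fix x
    have "0 < w (x + nat_mult (Suc n) a)" using w by (simp add: weight_def)
    then have "phi a w (Suc n) x powr p \<le> (C * phi a w n x) powr p"
      unfolding phi_Suc using p C(2)[of "x + nat_mult (Suc n) a"] phi_pos[of n x]
      by (intro powr_mono2) (auto simp: mult.commute)
    also have "\<dots> = C powr p * phi a w n x powr p"
      using C(1) phi_pos[of n x] by (simp add: powr_mult)
    finally have "ennreal (phi a w (Suc n) x powr p) * v x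
        \<le> ennreal (C powr p * phi a w n x powr p) * v x"
      by (intro mult_right_mono ennreal_leI) auto
    then show "ennreal (phi a w (Suc n) x powr p) * v x
        \<le> ennreal (C powr p) * (ennreal (phi a w n x powr p) * v x)"
      by (simp add: ennreal_mult' mult.assoc)
  qed
  also have "\<dots> = ennreal (C powr p * s n)"
    by (simp add: nn_integral_cmult s ennreal_mult')
  finally show "s (Suc n) \<le> C powr p * s n" using s0 by (simp add: ennreal_le_iff)
next
  fix s and c :: real assume "s \<in> orbit_powers M p a w" and c: "0 \<le> c"
  then obtain v where s0: "\<And>n. 0 \<le> s n" and v[measurable]: "v \<in> borel_measurable M"
    and s: "\<And>n. (\<integral>\<^sup>+x. ennreal (phi a w n x powr p) * v x \<partial>M) = ennreal (s n)"
    by (auto simp: orbit_powers_def)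
  have "(\<integral>\<^sup>+x. ennreal (phi a w n x powr p) * (ennreal c * v x) \<partial>M) = ennreal (c * s n)" for n
  proof -
    have "(\<integral>\<^sup>+x. ennreal (phi a w n x powr p) * (ennreal c * v x) \<partial>M)
        = (\<integral>\<^sup>+x. ennreal c * (ennreal (phi a w n x powr p) * v x) \<partial>M)"
      by (simp add: mult.left_commute)
    also have "\<dots> = ennreal (c * s n)" using c by (simp add: nn_integral_cmult s ennreal_mult')
    finally show ?thesis .
  qed
  then show "(\<lambda>n. c * s n) \<in> orbit_powers M p a w"
    using s0 c unfolding orbit_powers_def
    by (auto intro!: bexI[of _ "\<lambda>x. ennreal c * v x"])
next
  fix s assume "s \<in> orbit_powers M p a w"
  then obtain v where s0: "\<And>n. 0 \<le> s n" and v[measurable]: "v \<in> borel_measurable M"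
    and s: "\<And>n. (\<integral>\<^sup>+x. ennreal (phi a w n x powr p) * v x \<partial>M) = ennreal (s n)"
    by (auto simp: orbit_powers_def)
  note [measurable] = distr_shift(1)[OF M, of a]
  show "(\<lambda>n. s (Suc n)) \<in> orbit_powers M p a w"
    using s0 unfolding orbit_powers_def
    by (auto intro!: bexI[of _ "\<lambda>x. ennreal (w x powr p) * v (x - a)"] simp: nn_integral_phi_shift s)
next
  fix \<sigma> :: "nat \<Rightarrow> nat \<Rightarrow> real"
  assume "\<And>k. \<sigma> k \<in> orbit_powers M p a w" and summ: "\<And>n. summable (\<lambda>k. \<sigma> k n)"
  then have s0: "\<And>k n. 0 \<le> \<sigma> k n" and "\<And>k. \<exists>v. v \<in> borel_measurable M \<and>
      (\<forall>n. (\<integral>\<^sup>+x. ennreal (phi a w n x powr p) * v x \<partial>M) = ennreal (\<sigma> k n))"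
    unfolding orbit_powers_def by blast+
  then obtain v where v[measurable]: "\<And>k. v k \<in> borel_measurable M"
    and s: "\<And>k n. (\<integral>\<^sup>+x. ennreal (phi a w n x powr p) * v k x \<partial>M) = ennreal (\<sigma> k n)"
    by metis
  have "(\<integral>\<^sup>+x. ennreal (phi a w n x powr p) * (\<Sum>k. v k x) \<partial>M) = ennreal (\<Sum>k. \<sigma> k n)" for n
  proof -
    have "(\<integral>\<^sup>+x. ennreal (phi a w n x powr p) * (\<Sum>k. v k x) \<partial>M)
        = (\<integral>\<^sup>+x. (\<Sum>k. ennreal (phi a w n x powr p) * v k x) \<partial>M)"
      by (simp add: ennreal_suminf_cmult)
    also have "\<dots> = (\<Sum>k. ennreal (\<sigma> k n))" by (subst nn_integral_suminf) (simp_all add: s)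
    also have "\<dots> = ennreal (\<Sum>k. \<sigma> k n)" using s0 summ by (intro suminf_ennreal2)
    finally show ?thesis .
  qed
  then show "(\<lambda>n. \<Sum>k. \<sigma> k n) \<in> orbit_powers M p a w"
    using s0 summ unfolding orbit_powers_def
    by (auto intro!: bexI[of _ "\<lambda>x. \<Sum>k. v k x"] suminf_nonneg)
qed

text \<open>
  The only place where the summability of \<open>1 / \<phi>_n(g_n)\<close> over \<open>B\<close> enters.  The density \<open>v\<close>
  is a finite combination of indicators of neighbourhoods \<open>V n\<close> of \<open>g n\<close> inside \<open>K n\<close>, with
  \<open>n\<close> in a far piece \<open>F\<close> of \<open>B\<close>.  The \<open>n\<close>-th term has mass \<open>2 / \<phi>_n(g_n)^p\<close>, just enough
  to push the orbit above \<open>1\<close> at time \<open>n\<close>, while the total mass is at most twice a tail of the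
  summable series.  As the support lies in finitely many of the sets \<open>K n\<close>, the orbit tends to
  \<open>0\<close> along \<open>A\<close>.
\<close>

lemma orbit_powers_seed:
  assumes K: "\<And>n. n \<in> B \<Longrightarrow> compact (K n) \<and> g n \<in> interior (K n)"
    and null: "\<And>k. k \<in> B \<Longrightarrow> ((\<lambda>n. restricted_norm M p (phi a w n) (K k)) \<longlongrightarrow> 0)
                        (inf sequentially (principal A))"
    and B: "B \<subseteq> {1..}" "ereal \<delta> < upper_dens B" "(\<lambda>n. 1 / phi a w n (g n)) summable_on B"
    and \<eta>: "0 < \<eta>"
  shows "\<exists>s\<in>orbit_powers M p a w. s 0 < \<eta> \<and> null_along A s \<and>
           (\<exists>N\<ge>1. \<delta> * real N \<le> real (card {j \<in> {1..N}. 1 \<le> s j}))"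
proof -
  define b where "b n = phi a w n (g n) powr p" for n
  define V where "V n = interior (K n) \<inter> {x. b n / 2 < phi a w n x powr p}" for n
  define J where "J n k = enn2real (\<integral>\<^sup>+x. ennreal (phi a w k x powr p) * indicator (V n) x \<partial>M)" for n k
  define \<beta> where "\<beta> n = measure M (V n)" for n
  have b: "0 < b n" for n using phi_pos[of n "g n"] by (simp add: b_def)
  have V_open: "open (V n)" for n
    unfolding V_def by (intro open_Int open_interior open_Collect_less continuous_phi_powr continuous_intros)
  have V_sets [measurable]: "V n \<in> sets M" for n using V_open by (simp add: sets_M)
  have V_sub: "V n \<subseteq> K n" for n unfolding V_def using interior_subset by blast
  obtain C where C: "1 \<le> C" "\<And>x. w x \<le> C" using weight_bound by blast
  have int: "(\<integral>\<^sup>+x. ennreal (phi a w k x powr p) * indicator X x \<partial>M) < \<infinity>"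
    if "X \<in> sets M" "X \<subseteq> K n" "n \<in> B" for X k n
  proof -
    have Kc: "compact (K n)" using K[OF that(3)] by simp
    have "phi a w k x powr p \<le> (C ^ k) powr p" for x
    proof (intro powr_mono2)
      have "phi a w k x \<le> (\<Prod>j=1..k. C)"
        unfolding phi_def translation_def using w C(2)
        by (intro prod_mono) (auto simp: weight_def less_imp_le)
      then show "phi a w k x \<le> C ^ k" by simp
    qed (use p phi_pos[of k x] in auto)
    then have "(\<integral>\<^sup>+x. ennreal (phi a w k x powr p) * indicator X x \<partial>M)
        \<le> (\<integral>\<^sup>+x. ennreal ((C ^ k) powr p) * indicator X x \<partial>M)"
      by (intro nn_integral_mono mult_right_mono ennreal_leI) auto
    also have "\<dots> = ennreal ((C ^ k) powr p) * emeasure M X"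
      using that(1) by (rule nn_integral_cmult_indicator)
    also have "\<dots> \<le> ennreal ((C ^ k) powr p) * emeasure M (K n)"
      using that Kc by (intro mult_left_mono emeasure_mono) (auto simp: sets_M compact_imp_closed)
    also have "\<dots> < \<infinity>"
      using M Kc by (auto simp: right_Haar_measure_def ennreal_mult_less_top)
    finally show ?thesis .
  qed
  have J: "(\<integral>\<^sup>+x. ennreal (phi a w k x powr p) * indicator (V n) x \<partial>M) = ennreal (J n k)"
    if "n \<in> B" for n k
    unfolding J_def using int[OF V_sets V_sub that, of k] by simp
  have J0: "0 \<le> J n k" for n k by (simp add: J_def)
  have emV: "emeasure M (V n) < \<infinity>" if "n \<in> B" for n
    using int[OF V_sets V_sub that, of 0] by simp
  have \<beta>: "emeasure M (V n) = ennreal (\<beta> n)" "0 < \<beta> n" if "n \<in> B" for n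
  proof -
    show e: "emeasure M (V n) = ennreal (\<beta> n)"
      unfolding \<beta>_def using emV[OF that] by (intro emeasure_eq_ennreal_measure) auto
    have "g n \<in> V n" using K[OF that] b[of n] by (simp add: V_def b_def)
    then have "0 < emeasure M (V n)" using emeasure_right_Haar_open_pos[OF M V_open] by blast
    then show "0 < \<beta> n" unfolding e by simp
  qed
  have J_0: "J n 0 = \<beta> n" if "n \<in> B" for n
    using J[OF that, of 0] \<beta>[OF that] J0[of n 0] by simp
  have J_diag: "b n / 2 * \<beta> n \<le> J n n" if "n \<in> B" for n
  proof -
    have "ennreal (b n / 2 * \<beta> n) = (\<integral>\<^sup>+x. ennreal (b n / 2) * indicator (V n) x \<partial>M)"
      using b[of n] \<beta>[OF that] by (simp add: nn_integral_cmult_indicator ennreal_mult'[symmetric])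
    also have "\<dots> \<le> (\<integral>\<^sup>+x. ennreal (phi a w n x powr p) * indicator (V n) x \<partial>M)"
      by (intro nn_integral_mono) (auto simp: V_def indicator_def intro!: ennreal_leI)
    also have "\<dots> = ennreal (J n n)" by (rule J[OF that])
    finally show ?thesis using J0[of n n] by (simp add: ennreal_le_iff)
  qed
  have J_null: "((\<lambda>k. J n k) \<longlongrightarrow> 0) (inf sequentially (principal A))" if "n \<in> B" for n
  proof (rule tendsto_sandwich[where f = "\<lambda>_. 0"])
    have Kc: "K n \<in> sets M" using K[OF that] by (auto simp: sets_M compact_imp_closed)
    have le: "J n k \<le> restricted_norm M p (phi a w k) (K n) powr p" for k
    proof -
      define L where "L = (LINT x:K n|M. phi a w k x powr p)"
      have L: "L = enn2real (\<integral>\<^sup>+x. ennreal (phi a w k x powr p) * indicator (K n) x \<partial>M)"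
        unfolding L_def set_lebesgue_integral_def
        using Kc by (subst integral_eq_nn_integral) (auto simp: indicator_def intro!: arg_cong[of _ _ enn2real] nn_integral_cong)
      have "ennreal (J n k) \<le> (\<integral>\<^sup>+x. ennreal (phi a w k x powr p) * indicator (K n) x \<partial>M)"
        unfolding J[OF that, symmetric] using V_sub
        by (intro nn_integral_mono mult_left_mono) (auto simp: indicator_def)
      also have "\<dots> = ennreal L" unfolding L using int[OF Kc subset_refl that, of k] by simp
      finally have "J n k \<le> L" using L by (simp add: ennreal_le_iff)
      moreover have "restricted_norm M p (phi a w k) (K n) powr p = L"
        using p L by (simp add: restricted_norm_def L_def[symmetric] powr_powr)
      ultimately show ?thesis by simp
    qed
    show "\<forall>\<^sub>F k in inf sequentially (principal A). J n k
        \<le> restricted_norm M p (phi a w k) (K n) powr p"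
      using le by (intro always_eventually) simp
    show "((\<lambda>k. restricted_norm M p (phi a w k) (K n) powr p) \<longlongrightarrow> 0) (inf sequentially (principal A))"
      using null[OF that] p
      by (intro tendsto_zero_powrI tendsto_const always_eventually) (auto simp: restricted_norm_def)
  qed (use J0 in \<open>auto intro: always_eventually\<close>)
  define h where "h n = (if n \<in> B then 1 / phi a w n (g n) else 0)" for n
  have h0: "0 \<le> h n" for n using phi_pos[of n "g n"] by (simp add: h_def)
  have "h summable_on UNIV"
    using B(3) by (rule summable_on_cong_neutral[THEN iffD1, rotated -1]) (auto simp: h_def)
  then have "summable h" by (rule summable_on_imp_summable)
  moreover have "0 < min 1 (\<eta> / 2)" using \<eta> by simp
  ultimately obtain m where m: "\<And>n. norm (sum h {m..<n}) < min 1 (\<eta> / 2)"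
    unfolding summable_Cauchy by blast
  obtain N where N: "1 \<le> N" "\<delta> * real N < real (card (B \<inter> {m..N}))"
    using card_tail_of_upper_dens[OF B(2)] by blast
  define F where "F = B \<inter> {m..N}"
  have F: "finite F" "\<And>n. n \<in> F \<Longrightarrow> n \<in> B" by (auto simp: F_def)
  have sumF: "(\<Sum>n\<in>F. h n) < min 1 (\<eta> / 2)"
  proof -
    have "(\<Sum>n\<in>F. h n) \<le> sum h {m..<Suc N}" using h0 by (intro sum_mono2) (auto simp: F_def)
    also have "\<dots> \<le> norm (sum h {m..<Suc N})" by simp
    also have "\<dots> < min 1 (\<eta> / 2)" by (rule m)
    finally show ?thesis .
  qed
  define c where "c n = 2 / (b n * \<beta> n)" for n
  have c: "0 < c n" if "n \<in> F" for n using b[of n] \<beta>(2)[OF F(2)[OF that]] by (simp add: c_def)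
  define v where "v x = (\<Sum>n\<in>F. ennreal (c n) * indicator (V n) x)" for x
  define s where "s k = (\<Sum>n\<in>F. c n * J n k)" for k
  have s0: "0 \<le> s k" for k unfolding s_def using c J0 by (intro sum_nonneg) (simp add: less_imp_le)
  have "(\<integral>\<^sup>+x. ennreal (phi a w k x powr p) * v x \<partial>M) = ennreal (s k)" for k
  proof -
    have "(\<integral>\<^sup>+x. ennreal (phi a w k x powr p) * v x \<partial>M)
        = (\<integral>\<^sup>+x. (\<Sum>n\<in>F. ennreal (c n) * (ennreal (phi a w k x powr p) * indicator (V n) x)) \<partial>M)"
      by (simp add: v_def sum_distrib_left mult.left_commute)
    also have "\<dots> = (\<Sum>n\<in>F. \<integral>\<^sup>+x. ennreal (c n) * (ennreal (phi a w k x powr p) * indicator (V n) x) \<partial>M)"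
      by (rule nn_integral_sum) measurable
    also have "\<dots> = (\<Sum>n\<in>F. ennreal (c n * J n k))"
      using c J0 by (intro sum.cong) (simp_all add: nn_integral_cmult J F(2) ennreal_mult less_imp_le)
    also have "\<dots> = ennreal (s k)"
      unfolding s_def using c J0 by (intro sum_ennreal) (simp add: less_imp_le)
    finally show ?thesis .
  qed
  moreover have "v \<in> borel_measurable M" unfolding v_def by measurable
  ultimately have s: "s \<in> orbit_powers M p a w" using s0 unfolding orbit_powers_def by blast
  have "s 0 = (\<Sum>n\<in>F. 2 * (1 / phi a w n (g n)) powr p)"
    unfolding s_def
  proof (rule sum.cong)
    fix n assume n: "n \<in> F"
    then show "c n * J n 0 = 2 * (1 / phi a w n (g n)) powr p"
      using \<beta>(2)[OF F(2)[OF n]] phi_pos[of n "g n"]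
      by (simp add: c_def J_0[OF F(2)[OF n]] b_def powr_divide)
  qed simp
  also have "\<dots> \<le> (\<Sum>n\<in>F. 2 * h n)"
  proof (rule sum_mono)
    fix n assume n: "n \<in> F"
    \<comment> \<open>Terms below 1 only shrink when raised to the power p.\<close>
    have "h n \<le> (\<Sum>n\<in>F. h n)" using n F(1) h0 by (intro member_le_sum) auto
    then have "h n \<le> 1" using sumF by simp
    then have "h n powr p \<le> h n powr 1" using h0 p by (intro powr_mono') auto
    then show "2 * (1 / phi a w n (g n)) powr p \<le> 2 * h n"
      using h0[of n] F(2)[OF n] by (simp add: h_def)
  qed
  also have "\<dots> < \<eta>" using sumF by (simp add: sum_distrib_left[symmetric])
  finally have "s 0 < \<eta>" .
  moreover have "null_along A s"
    unfolding null_along_def s_def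
    by (intro tendsto_null_sum tendsto_mult_right_zero J_null F(2))
  moreover have "\<delta> * real N \<le> real (card {j \<in> {1..N}. 1 \<le> s j})"
  proof -
    have "1 \<le> s j" if "j \<in> F" for j
    proof -
      have "1 = c j * (b j / 2 * \<beta> j)" using b[of j] \<beta>(2)[OF F(2)[OF that]] by (simp add: c_def)
      also have "\<dots> \<le> c j * J j j" using J_diag[OF F(2)[OF that]] c[OF that] by simp
      also have "\<dots> \<le> s j"
        unfolding s_def using that F(1) c J0 by (intro member_le_sum) (auto simp: less_imp_le)
      finally show ?thesis .
    qed
    then have "card F \<le> card {j \<in> {1..N}. 1 \<le> s j}"
      using B(1) by (intro card_mono) (auto simp: F_def)
    then show ?thesis using N(2) unfolding F_def[symmetric] by linarith
  qed
  ultimately show ?thesis using s N(1) by blast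
qed

lemma Lp_fnorm_eq:
  assumes "f \<in> borel_measurable M" "(\<integral>\<^sup>+x. ennreal (norm (f x) powr p) \<partial>M) = ennreal r" "0 \<le> r"
  shows "f \<in> Lp_fun M p" "Lp_fnorm M p f = r powr (1 / p)"
proof -
  have [measurable]: "f \<in> borel_measurable M" by fact
  have "integrable M (\<lambda>x. norm (f x) powr p)"
    by (rule integrableI_nonneg) (use assms(2) in auto)
  then show "f \<in> Lp_fun M p" by (simp add: Lp_fun_def)
  have "(LINT x|M. norm (f x) powr p) = r"
    using assms(2,3) by (subst integral_eq_nn_integral) auto
  then show "Lp_fnorm M p f = r powr (1 / p)" by (simp add: Lp_fnorm_def)
qed

lemma weighted_translation_power_class:
  assumes "f \<in> Lp_fun M p"
  shows "(wtrans_fun a w ^^ n) f \<in> Lp_fun M p"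
    and "(weighted_translation M p a w ^^ n) (Lp_rel M p `` {f}) = Lp_rel M p `` {(wtrans_fun a w ^^ n) f}"
proof -
  obtain C where C: "\<And>x. w x \<le> C" using weight_bound by blast
  show in_Lp: "(wtrans_fun a w ^^ n) f \<in> Lp_fun M p" for n
    by (induction n) (simp_all add: assms wtrans_fun_Lp(1)[OF M p w _ C])
  show "(weighted_translation M p a w ^^ n) (Lp_rel M p `` {f}) = Lp_rel M p `` {(wtrans_fun a w ^^ n) f}"
    by (induction n) (simp_all add: weighted_translation_class[OF M p w in_Lp])
qed

text \<open>
  The line spanned by a function \<open>f\<close> with \<open>\<bar>f\<bar>^p = v\<close>: by linearity the distance of the
  orbits of \<open>c f\<close> and \<open>d f\<close> is a multiple of the norm of \<open>T^n f\<close>.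
\<close>

lemma orbit_powers_realized:
  assumes "s \<in> orbit_powers M p a w"
  obtains f where "\<And>c. (\<lambda>x. complex_of_real c * f x) \<in> Lp_fun M p"
    "\<And>c d n. Lp_norm M p (Lp_diff M p
         ((weighted_translation M p a w ^^ n) (Lp_rel M p `` {\<lambda>x. complex_of_real c * f x}))
         ((weighted_translation M p a w ^^ n) (Lp_rel M p `` {\<lambda>x. complex_of_real d * f x})))
       = \<bar>c - d\<bar> * s n powr (1 / p)"
proof -
  obtain v where s0: "\<And>n. 0 \<le> s n" and v[measurable]: "v \<in> borel_measurable M"
    and s: "\<And>n. (\<integral>\<^sup>+x. ennreal (phi a w n x powr p) * v x \<partial>M) = ennreal (s n)"
    using assms by (auto simp: orbit_powers_def)
  define f where "f x = complex_of_real (enn2real (v x) powr (1 / p))" for x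
  have [measurable]: "f \<in> borel_measurable M" unfolding f_def by measurable
  have fp: "norm (f x) powr p = enn2real (v x)" for x
    using p by (simp add: f_def powr_powr)
  have "(\<integral>\<^sup>+x. v x \<partial>M) = ennreal (s 0)" using s[of 0] by (simp add: phi_pos)
  \<comment> \<open>Where v is infinite, f vanishes instead; this happens on a null set only.\<close>
  then have "AE x in M. v x \<noteq> \<infinity>" by (intro nn_integral_PInf_AE) auto
  then have ae: "AE x in M. ennreal (norm (f x) powr p) = v x"
    by eventually_elim (simp add: fp less_top)
  have f_s: "(\<integral>\<^sup>+x. ennreal (phi a w n x powr p) * ennreal (norm (f x) powr p) \<partial>M) = ennreal (s n)" for n
    unfolding s[symmetric] by (rule nn_integral_cong_AE) (use ae in eventually_elim, simp)
  have cf: "(\<integral>\<^sup>+x. ennreal (phi a w n x powr p) * ennreal (norm (complex_of_real c * f x) powr p) \<partial>M)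
      = ennreal (\<bar>c\<bar> powr p * s n)" for c n
  proof -
    have "(\<integral>\<^sup>+x. ennreal (phi a w n x powr p) * ennreal (norm (complex_of_real c * f x) powr p) \<partial>M)
      = (\<integral>\<^sup>+x. ennreal (\<bar>c\<bar> powr p) * (ennreal (phi a w n x powr p) * ennreal (norm (f x) powr p)) \<partial>M)"
      by (simp add: norm_mult powr_mult ennreal_mult' mult.left_commute)
    also have "\<dots> = ennreal (\<bar>c\<bar> powr p * s n)" by (simp add: nn_integral_cmult f_s ennreal_mult')
    finally show ?thesis .
  qed
  have cf_Lp: "(\<lambda>x. complex_of_real c * f x) \<in> Lp_fun M p" for c
    by (rule Lp_fnorm_eq(1)) (use cf[of 0 c] s0 in auto)
  have lin: "(wtrans_fun a w ^^ n) (\<lambda>x. complex_of_real c * f x)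
      = (\<lambda>x. complex_of_real c * (wtrans_fun a w ^^ n) f x)" for c n
    by (induction n) (simp_all add: wtrans_fun_def translation_def fun_eq_iff mult.left_commute)
  have "Lp_norm M p (Lp_diff M p
         ((weighted_translation M p a w ^^ n) (Lp_rel M p `` {\<lambda>x. complex_of_real c * f x}))
         ((weighted_translation M p a w ^^ n) (Lp_rel M p `` {\<lambda>x. complex_of_real d * f x})))
       = \<bar>c - d\<bar> * s n powr (1 / p)" for c d n
  proof -
    let ?g = "\<lambda>x. complex_of_real (c - d) * f x"
    have diff: "(\<lambda>x. (wtrans_fun a w ^^ n) (\<lambda>x. complex_of_real c * f x) x
        - (wtrans_fun a w ^^ n) (\<lambda>x. complex_of_real d * f x) x) = (wtrans_fun a w ^^ n) ?g"
      unfolding lin by (simp add: left_diff_distrib)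
    have gn: "(wtrans_fun a w ^^ n) ?g \<in> Lp_fun M p"
      by (rule weighted_translation_power_class(1)[OF cf_Lp])
    have "(\<integral>\<^sup>+x. ennreal (norm ((wtrans_fun a w ^^ n) ?g x) powr p) \<partial>M)
        = ennreal (\<bar>c - d\<bar> powr p * s n)"
      using nn_integral_wtrans_power[of ?g 0 n] cf[of n "c - d"] by simp
    then have "Lp_fnorm M p ((wtrans_fun a w ^^ n) ?g) = (\<bar>c - d\<bar> powr p * s n) powr (1 / p)"
      using s0[of n] gn by (intro Lp_fnorm_eq(2)) (auto simp: Lp_fun_def)
    also have "\<dots> = \<bar>c - d\<bar> * s n powr (1 / p)"
      using p by (simp add: powr_mult powr_powr)
    finally show ?thesis
      by (simp only: weighted_translation_power_class(2)[OF cf_Lp] diff gn Lp_norm_class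
          Lp_diff_class[OF p weighted_translation_power_class(1)[OF cf_Lp]
            weighted_translation_power_class(1)[OF cf_Lp]])
  qed
  with cf_Lp show ?thesis by (rule that)
qed

end

section \<open>Distributional chaos\<close>

theorem theorem2p9:
  fixes M :: "'a::{topological_group_add, second_countable_topology, t2_space} measure"
    and p :: real and a :: 'a and w :: "'a \<Rightarrow> real"
  assumes "locally_compact_space (euclidean :: 'a topology)"
    and "right_Haar_measure M"
    and "1 \<le> p"
    and "weight w"
    and "DCCW M p a w"
  shows "distributionally_chaotic (Lp_space M p) (Lp_diff M p) (Lp_norm M p)
           (weighted_translation M p a w)"
proof -
  note M = assms(2) and p = assms(3) and w = assms(4)
  obtain g A K B where A: "A \<subseteq> {1..}" "upper_dens A = 1"
    and K: "\<And>n. 1 \<le> n \<Longrightarrow> compact (K n) \<and> g n \<in> interior (K n)"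
    and null: "\<And>k. 1 \<le> k \<Longrightarrow> ((\<lambda>n. restricted_norm M p (phi a w n) (K k)) \<longlongrightarrow> 0)
                        (inf sequentially (principal A))"
    and B: "B \<subseteq> {1..}" "upper_dens B > 0" "(\<lambda>n. 1 / phi a w n (g n)) summable_on B"
    using assms(5) unfolding DCCW_def by blast
  obtain \<delta> where \<delta>: "0 < ereal \<delta>" "ereal \<delta> < upper_dens B" using ereal_dense2[OF B(2)] by blast
  obtain C where C: "1 \<le> C" "\<And>x. w x \<le> C" using weight_bound[OF M p w] by blast
  interpret orbit_cone "orbit_powers M p a w" "C powr p"
    by (rule orbit_cone_orbit_powers[OF M p w C])
  have B1: "1 \<le> n" if "n \<in> B" for n using that B(1) by auto
  have seed: "\<exists>s\<in>orbit_powers M p a w. s 0 < \<eta> \<and> null_along A s \<and>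
      (\<exists>N\<ge>1. \<delta> * real N \<le> real (card {j \<in> {1..N}. 1 \<le> s j}))" if "0 < \<eta>" for \<eta>
    by (rule orbit_powers_seed[OF M p w K[OF B1] null[OF B1] B(1) \<delta>(2) B(3) that])
  obtain s where s: "s \<in> orbit_powers M p a w"
    and small: "\<And>\<tau>. 0 < \<tau> \<Longrightarrow> upper_dens {n. 1 \<le> n \<and> s n < \<tau>} = 1"
    and large: "\<And>R. upper_dens {n. 1 \<le> n \<and> R \<le> s n} = 1"
    using irregular_element[OF A(2,1) _ seed] \<delta>(1) by auto
  have s0: "0 \<le> s n" for n using nonneg[OF s] .
  obtain f where f: "\<And>c. (\<lambda>x. complex_of_real c * f x) \<in> Lp_fun M p"
    and dist: "\<And>c d n. Lp_norm M p (Lp_diff M p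
         ((weighted_translation M p a w ^^ n) (Lp_rel M p `` {\<lambda>x. complex_of_real c * f x}))
         ((weighted_translation M p a w ^^ n) (Lp_rel M p `` {\<lambda>x. complex_of_real d * f x})))
       = \<bar>c - d\<bar> * s n powr (1 / p)"
    using orbit_powers_realized[OF M p w s] by blast
  \<comment> \<open>The scrambled set is the real line through f.\<close>
  define \<gamma> where "\<gamma> c = Lp_rel M p `` {\<lambda>x. complex_of_real c * f x}" for c
  have "0 < s 0"
  proof (rule ccontr)
    assume "\<not> 0 < s 0"
    then have "s n \<le> 0" for n using growth_power[OF s, of 0 n] s0[of 0] by simp
    then have "\<not> 1 \<le> s n" for n by (meson not_one_le_zero order_trans)
    then have empty: "{n. 1 \<le> n \<and> 1 \<le> s n} = {}" by blast
    have "upper_dens {} = 1" using large[of 1] unfolding empty .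
    then show False by (simp add: upper_dens_def Limsup_const zero_ereal_def[symmetric])
  qed
  have "inj \<gamma>"
  proof (rule injI)
    fix c d assume eq: "\<gamma> c = \<gamma> d"
    have "\<bar>c - d\<bar> * s 0 powr (1 / p) = Lp_norm M p (Lp_diff M p (\<gamma> c) (\<gamma> d))"
      using dist[of 0 c d] by (simp add: \<gamma>_def)
    also have "\<dots> = Lp_norm M p (Lp_diff M p (\<gamma> c) (\<gamma> c))" by (simp only: eq)
    also have "\<dots> = 0" using dist[of 0 c c] by (simp add: \<gamma>_def)
    finally show "c = d" using \<open>0 < s 0\<close> by simp
  qed
  have chaos: "upper_dens {n. 1 \<le> n \<and> 1 \<le> Lp_norm M p (Lp_diff M p
        ((weighted_translation M p a w ^^ n) (\<gamma> c)) ((weighted_translation M p a w ^^ n) (\<gamma> d)))} = 1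
      \<and> upper_dens {n. 1 \<le> n \<and> Lp_norm M p (Lp_diff M p
        ((weighted_translation M p a w ^^ n) (\<gamma> c)) ((weighted_translation M p a w ^^ n) (\<gamma> d))) < \<tau>} = 1"
    if "c \<noteq> d" "0 < \<tau>" for c d \<tau>
  proof -
    define e where "e = \<bar>c - d\<bar>"
    have e: "0 < e" using that(1) by (simp add: e_def)
    have less_iff: "e * s n powr (1 / p) < r \<longleftrightarrow> s n < (r / e) powr p" if "0 < r" for n r
    proof -
      have "e * s n powr (1 / p) < r \<longleftrightarrow> s n powr (1 / p) < r / e" using e by (simp add: field_simps)
      also have "r / e = ((r / e) powr p) powr (1 / p)" using that e p by (simp add: powr_powr)
      also have "s n powr (1 / p) < \<dots> \<longleftrightarrow> s n < (r / e) powr p"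
        using p s0[of n] powr_less_mono2[of "1 / p"] powr_mono2[of "1 / p" "(r / e) powr p" "s n"]
        by (auto simp: not_le[symmetric])
      finally show ?thesis .
    qed
    have "1 \<le> e * s n powr (1 / p) \<longleftrightarrow> (1 / e) powr p \<le> s n" for n
      using less_iff[of 1 n] by (simp add: not_less[symmetric])
    moreover have "0 < (\<tau> / e) powr p" using that e by simp
    ultimately show ?thesis
      unfolding \<gamma>_def dist e_def[symmetric] using less_iff[OF that(2)] small large by simp
  qed
  show ?thesis
    unfolding distributionally_chaotic_def
  proof (intro exI conjI allI impI ballI)
    show "range \<gamma> \<subseteq> Lp_space M p" using f by (auto simp: \<gamma>_def Lp_space_def intro: quotientI)
    show "uncountable (range \<gamma>)"
      using \<open>inj \<gamma>\<close> uncountable_UNIV_real by (simp add: countable_image_inj_eq)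
    show "(0::real) < 1" by simp
  next
    fix \<tau> :: real and x y assume \<tau>: "0 < \<tau>" and xy: "x \<in> range \<gamma>" "y \<in> range \<gamma>" "x \<noteq> y"
    then obtain c d where cd: "x = \<gamma> c" "y = \<gamma> d" "c \<noteq> d" by blast
    show "upper_dens {n. 1 \<le> n \<and> 1 \<le> Lp_norm M p (Lp_diff M p
        ((weighted_translation M p a w ^^ n) x) ((weighted_translation M p a w ^^ n) y))} = 1"
      using chaos[OF cd(3) \<tau>] unfolding cd by blast
    show "upper_dens {n. 1 \<le> n \<and> Lp_norm M p (Lp_diff M p
        ((weighted_translation M p a w ^^ n) x) ((weighted_translation M p a w ^^ n) y)) < \<tau>} = 1"
      using chaos[OF cd(3) \<tau>] unfolding cd by blast
  qed
qed

end
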